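(* Let $(V,h)$ be an $n$-dimensional Euclidean vector space. The products of the $O(n)$-irreducible submodules of $\mathcal{MC}(V^* )$ satisfy: (i) $\mathcal{MC}_S(V^* )\ast\mathcal{MC}_S(V^* )=\mathcal{MC}_S(V^* )$ if $n>1$; (ii) $\mathcal{MC}_R(V^* )\ast\mathcal{MC}_S(V^* )=\mathcal{MC}_R(V^* )$ if $n>2$; (iii) $\mathcal{MC}_W(V^* )\ast\mathcal{MC}_S(V^* )=\{0\}$; (iv) $\mathcal{MC}_W(V^* )\ast\mathcal{MC}_R(V^* )=\mathcal{MC}_R(V^* )$ if $n>3$; (v) $\operatorname{tf}(\mathcal{MC}_R(V^* )\ast\mathcal{MC}_R(V^* ))=\mathcal{MC}_W(V^* )$ if $n>3$; (vi) $\mathcal{MC}_W(V^* )\ast\mathcal{MC}_W(V^* )=\mathcal{MC}_W(V^* )$ if $n>3$.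
   Context: All vector spaces are finite-dimensional over $\mathbb{R}$. A Euclidean vector space $(V,h)$ has a positive definite symmetric bilinear form $h_{ij}$; indices are raised and lowered with $h$. Brackets around indices denote complete antisymmetrization, normalized to be a projection. $\mathcal{MC}(V^* )=\{Y_{ijkl}\in\otimes^4V^*: Y_{[ij]kl}=Y_{ijkl}=Y_{ij[kl]},\ Y_{[ijk]l}=0\}$, with inner product $\langle X,Y\rangle=X_{ijkl}Y^{ijkl}$. The Ricci trace is $\rho(Y)_{ij}=Y_{pij}{}^{p}$. For $\alpha,\beta\in S^2V^*$, $(\alpha\curlywedge\beta)_{ijkl}=\alpha_{k[i}\beta_{j]l}-\alpha_{l[i}\beta_{j]k}\in\mathcal{MC}(V^* )$. Set $\mathcal{MC}_W(V^* )=\ker\rho$, $\mathcal{MC}_R(V^* )=\{h\curlywedge\alpha:\alpha\in S^2V^*,\ h^{ij}\alpha_{ij}=0\}$, $\mathcal{MC}_S(V^* )=\operatorname{span}\{h\curlywedge h\}$. $\operatorname{tf}$ is the orthogonal projection of $\mathcal{MC}(V^* )$ onto $\mathcal{MC}_W(V^* )$. For $X\in\mathcal{MC}(V^* )$, $\widehat X\in\operatorname{End}(\otimes^kV^* )$ is $$\widehat X(\alpha)_{i_1\dots i_k}=\tfrac1k\sum_{r\ne s}X^{p}{}_{i_ri_s}{}^{q}\,\alpha_{i_1\dots p\dots q\dots i_k},$$ the sum running over ordered pairs $(r,s)$ of distinct positions, with $p$ in position $r$ and $q$ in position $s$. The commutative multiplication on $\mathcal{MC}(V^* )$ is $X\ast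 Y:=\widehat X(Y)$. For subspaces $U_1,U_2\subset\mathcal{MC}(V^* )$, $U_1\ast U_2$ denotes the linear span of all products $X\ast Y$ with $X\in U_1$, $Y\in U_2$. *)

theory Defs
  imports "HOL-Analysis.Analysis" "HOL-Library.Function_Algebras"
begin

text \<open>The Euclidean vector space \<open>(V, h)\<close> is a type \<open>'a\<close> of class \<^class>\<open>euclidean_space\<close>, with
  \<open>h\<close> its inner product and \<open>dim V = DIM('a)\<close>.  Covariant tensors are multilinear functions, so
  \<open>Y\<^sub>i\<^sub>j\<^sub>k\<^sub>l\<close> is \<open>Y i j k l\<close> for vectors \<open>i j k l\<close>.  Raising an index with \<open>h\<close> and contracting it
  amounts to summing over the orthonormal basis \<^const>\<open>Basis\<close>.\<close>

text \<open>Pointwise scalar multiplication; the pointwise additive structure is in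
  \<^theory>\<open>HOL-Library.Function_Algebras\<close>.\<close>

instantiation "fun" :: (type, scaleR) scaleR
begin
definition scaleR_fun_def: "r *\<^sub>R f = (\<lambda>x. r *\<^sub>R f x)"
instance ..
end

instance "fun" :: (type, real_vector) real_vector
  by standard (simp_all add: scaleR_fun_def fun_eq_iff scaleR_add_left scaleR_add_right)

type_synonym 'a form4 = "'a \<Rightarrow> 'a \<Rightarrow> 'a \<Rightarrow> 'a \<Rightarrow> real"

definition multilinear4 :: "('a::real_vector) form4 \<Rightarrow> bool" where
  "multilinear4 Y \<longleftrightarrow>
     (\<forall>j k l. linear (\<lambda>i. Y i j k l)) \<and> (\<forall>i k l. linear (\<lambda>j. Y i j k l)) \<and>
     (\<forall>i j l. linear (\<lambda>k. Y i j k l)) \<and> (\<forall>i j k. linear (\<lambda>l. Y i j k l))"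

definition MC :: "('a::euclidean_space) form4 set" where
  "MC = {Y. multilinear4 Y \<and>
     (\<forall>i j k l. 1/2 * (Y i j k l - Y j i k l) = Y i j k l) \<and>
     (\<forall>i j k l. 1/2 * (Y i j k l - Y i j l k) = Y i j k l) \<and>
     (\<forall>i j k l. 1/6 * (Y i j k l + Y j k i l + Y k i j l
                      - Y j i k l - Y i k j l - Y k j i l) = 0)}"

definition form_inner :: "('a::euclidean_space) form4 \<Rightarrow> 'a form4 \<Rightarrow> real" where
  "form_inner X Y = (\<Sum>i\<in>Basis. \<Sum>j\<in>Basis. \<Sum>k\<in>Basis. \<Sum>l\<in>Basis. X i j k l * Y i j k l)"

definition ricci :: "('a::euclidean_space) form4 \<Rightarrow> 'a \<Rightarrow> 'a \<Rightarrow> real" where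
  "ricci Y i j = (\<Sum>p\<in>Basis. Y p i j p)"

definition sym_forms :: "('a::euclidean_space \<Rightarrow> 'a \<Rightarrow> real) set" where
  "sym_forms = {\<alpha>. bilinear \<alpha> \<and> (\<forall>i j. \<alpha> i j = \<alpha> j i)}"

definition trace_form :: "('a::euclidean_space \<Rightarrow> 'a \<Rightarrow> real) \<Rightarrow> real" where
  "trace_form \<alpha> = (\<Sum>i\<in>Basis. \<alpha> i i)"

text \<open>The product \<open>\<alpha>\<^sub>k\<^sub>[\<^sub>i \<beta>\<^sub>j\<^sub>]\<^sub>l - \<alpha>\<^sub>l\<^sub>[\<^sub>i \<beta>\<^sub>j\<^sub>]\<^sub>k\<close>.\<close>

definition curlywedge ::
    "('a \<Rightarrow> 'a \<Rightarrow> real) \<Rightarrow> ('a \<Rightarrow> 'a \<Rightarrow> real) \<Rightarrow> ('a::euclidean_space) form4" where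
  "curlywedge \<alpha> \<beta> i j k l =
     1/2 * (\<alpha> k i * \<beta> j l - \<alpha> k j * \<beta> i l) - 1/2 * (\<alpha> l i * \<beta> j k - \<alpha> l j * \<beta> i k)"

definition MC_W :: "('a::euclidean_space) form4 set" where
  "MC_W = {Y \<in> MC. ricci Y = 0}"

definition MC_R :: "('a::euclidean_space) form4 set" where
  "MC_R = {curlywedge inner \<alpha> | \<alpha>. \<alpha> \<in> sym_forms \<and> trace_form \<alpha> = 0}"

definition MC_S :: "('a::euclidean_space) form4 set" where
  "MC_S = span {curlywedge inner inner}"

text \<open>Orthogonal projection of \<^const>\<open>MC\<close> onto \<^const>\<open>MC_W\<close>; only meaningful on \<^const>\<open>MC\<close>.\<close>

definition tf :: "('a::euclidean_space) form4 \<Rightarrow> 'a form4" where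
  "tf X = (THE W. W \<in> MC_W \<and> (\<forall>Z\<in>MC_W. form_inner (X - W) Z = 0))"

text \<open>Here a tensor of arbitrary rank \<open>k\<close> takes the list of its \<open>k\<close> arguments, so that the endomorphisms
  for all \<open>k\<close> are given at once.\<close>

definition hat :: "('a::euclidean_space) form4 \<Rightarrow> ('a list \<Rightarrow> real) \<Rightarrow> 'a list \<Rightarrow> real" where
  "hat X \<alpha> v = 1 / real (length v) *
     (\<Sum>r<length v. \<Sum>s\<in>{..<length v} - {r}.
        \<Sum>p\<in>Basis. \<Sum>q\<in>Basis. X p (v ! r) (v ! s) q * \<alpha> (v[r := p, s := q]))"

definition mc_mult :: "('a::euclidean_space) form4 \<Rightarrow> 'a form4 \<Rightarrow> 'a form4"  (infixl "\<circledast>" 70) where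
  "(X \<circledast> Y) i j k l = hat X (\<lambda>v. Y (v ! 0) (v ! 1) (v ! 2) (v ! 3)) [i, j, k, l]"

definition mc_mult_span :: "('a::euclidean_space) form4 set \<Rightarrow> 'a form4 set \<Rightarrow> 'a form4 set"
    (infixl "\<circledast>\<^sub>s" 70) where
  "U \<circledast>\<^sub>s U' = span {X \<circledast> Y | X Y. X \<in> U \<and> Y \<in> U'}"

end

theory Submission
  imports Defs
begin

text \<open>For \<open>X \<in> MC\<close> and symmetric \<open>\<alpha>\<close>, expanding the contractions and cancelling by the Bianchi identity
  gives \<open>X \<circledast> (h \<and> \<alpha>) = (\<rho>(X) \<and> \<alpha> + h \<and> X\<alpha>) / 2\<close>, where \<open>X\<alpha>\<close> is the action of \<open>X\<close> on symmetric
  two-tensors; together with \<open>\<rho>(h \<and> \<alpha>) = ((2 - n) \<alpha> - tr \<alpha> h) / 2\<close> this settles (i)-(iii).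
  The equalities (iv)-(vi) rest on the Weyl tensors \<open>2 (a\<^sup>2 - b\<^sup>2) \<and> (c\<^sup>2 - d\<^sup>2)\<close> with \<open>a, b, c, d\<close>
  orthonormal.  They span \<open>MC_W\<close>: testing a Weyl tensor that is orthogonal to all of them on basis
  vectors, with \<open>a, b\<close> or \<open>c, d\<close> possibly rotated by 45 degrees, forces its components to vanish.
  For fixed \<open>a, b, c, d\<close> let \<open>P\<close>, \<open>Q\<close>, \<open>R\<close> be the sums of the squared bivectors over the
  matchings \<open>ac|bd\<close>, \<open>ad|bc\<close>, \<open>ab|cd\<close>.  Then \<open>(P - Q)\<^sup>2 = 2 R - P - Q\<close> and cyclically, so the spanning
  element \<open>P - Q\<close> is a combination of the squares of the Weyl tensors \<open>P - R\<close> and \<open>Q - R\<close>.\<close>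

subsection \<open>Curvature tensors and the product\<close>

text \<open>Once \<open>Y\<close> is skew in its first two slots, the six-term antisymmetrization is
  twice the cyclic sum, so the last condition becomes the first Bianchi identity.\<close>

lemma mem_MC_iff:
  "Y \<in> MC \<longleftrightarrow> multilinear4 Y \<and> (\<forall>i j k l. Y j i k l = - Y i j k l) \<and>
     (\<forall>i j k l. Y i j l k = - Y i j k l) \<and> (\<forall>i j k l. Y i j k l + Y j k i l + Y k i j l = 0)"
  (is "?L \<longleftrightarrow> ?R")
proof
  assume L: ?L
  have a: "Y j i k l = - Y i j k l" for i j k l
  proof -
    have "1/2 * (Y i j k l - Y j i k l) = Y i j k l" using L unfolding MC_def by blast
    then show ?thesis by (simp add: field_simps)
  qed
  have b: "Y i j l k = - Y i j k l" for i j k l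
  proof -
    have "1/2 * (Y i j k l - Y i j l k) = Y i j k l" using L unfolding MC_def by blast
    then show ?thesis by (simp add: field_simps)
  qed
  have c: "Y i j k l + Y j k i l + Y k i j l = 0" for i j k l
  proof -
    have "1/6 * (Y i j k l + Y j k i l + Y k i j l - Y j i k l - Y i k j l - Y k j i l) = 0"
      using L unfolding MC_def by blast
    then show ?thesis using a[of j i k l] a[of k j i l] a[of i k j l] by simp
  qed
  show ?R using L a b c unfolding MC_def by blast
next
  assume R: ?R
  have a: "Y j i k l = - Y i j k l" and b: "Y i j l k = - Y i j k l"
    and c: "Y i j k l + Y j k i l + Y k i j l = 0" for i j k l using R by blast+
  have "Y i j k l + Y j k i l + Y k i j l - Y j i k l - Y i k j l - Y k j i l = 0" for i j k l
    using c[of i j k l] a[of j i k l] a[of k j i l] a[of i k j l] by simp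
  moreover have "Y i j k l - Y j i k l = 2 * Y i j k l" "Y i j k l - Y i j l k = 2 * Y i j k l" for i j k l
    using a[of j i k l] b[of i j l k] by simp_all
  moreover have "multilinear4 Y" using R by blast
  ultimately show ?L unfolding MC_def by simp
qed

lemma MC_swap12: "Y \<in> MC \<Longrightarrow> Y j i k l = - Y i j k l"
  and MC_swap34: "Y \<in> MC \<Longrightarrow> Y i j l k = - Y i j k l"
  and MC_bianchi: "Y \<in> MC \<Longrightarrow> Y i j k l + Y j k i l + Y k i j l = 0"
  and MC_multilinear: "Y \<in> MC \<Longrightarrow> multilinear4 Y"
  unfolding mem_MC_iff by blast+

text \<open>The classical octahedron argument: the Bianchi identities with each of the four vectors
  in the last slot are combined, and the two skew symmetries cancel the surplus terms.\<close>

lemma MC_pair: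
  assumes "Y \<in> MC" shows "Y k l i j = Y i j k l"
  using MC_bianchi[OF assms, of i j k l] MC_bianchi[OF assms, of j k l i]
    MC_bianchi[OF assms, of k l i j] MC_bianchi[OF assms, of l i j k]
    MC_swap12[OF assms, of k l i j] MC_swap12[OF assms, of k j l i] MC_swap12[OF assms, of l i j k]
    MC_swap12[OF assms, of i k j l] MC_swap12[OF assms, of l j k i]
    MC_swap34[OF assms] MC_swap12[OF assms]
  by (smt (verit))

section \<open>Double contractions and the explicit form of the product\<close>

definition contract :: "('a::euclidean_space \<Rightarrow> 'a \<Rightarrow> real) \<Rightarrow> real" where
  "contract F = (\<Sum>p\<in>Basis. \<Sum>q\<in>Basis. F p q)"

lemma contract_add: "contract (\<lambda>p q. F p q + G p q) = contract F + contract G"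
  and contract_diff: "contract (\<lambda>p q. F p q - G p q) = contract F - contract G"
  and contract_uminus: "contract (\<lambda>p q. - F p q) = - contract F"
  and contract_cmult: "contract (\<lambda>p q. c * F p q) = c * contract F"
  and contract_zero: "contract (\<lambda>p q. 0) = 0"
  by (simp_all add: contract_def sum.distrib sum_subtractf sum_negf sum_distrib_left sum_distrib_right)

lemma contract_swap: "contract (\<lambda>p q. F q p) = contract F"
  unfolding contract_def by (rule sum.swap)

text \<open>The rank is 4, so \<open>hat\<close> sums over the twelve ordered pairs of distinct
  slots; here each pair (r, s) stands next to (s, r).\<close>

lemma mult_expand:
  "(X \<circledast> Y) i j k l = 1/4 *
     (contract (\<lambda>p q. X p i j q * Y p q k l) + contract (\<lambda>p q. X p j i q * Y q p k l)
    + contract (\<lambda>p q. X p i k q * Y p j q l) + contract (\<lambda>p q. X p k i q * Y q j p l)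
    + contract (\<lambda>p q. X p i l q * Y p j k q) + contract (\<lambda>p q. X p l i q * Y q j k p)
    + contract (\<lambda>p q. X p j k q * Y i p q l) + contract (\<lambda>p q. X p k j q * Y i q p l)
    + contract (\<lambda>p q. X p j l q * Y i p k q) + contract (\<lambda>p q. X p l j q * Y i q k p)
    + contract (\<lambda>p q. X p k l q * Y i j p q) + contract (\<lambda>p q. X p l k q * Y i j q p))"
proof -
  have d: "{..<4} - {0} = {1,2,3::nat}" "{..<4} - {1} = {0,2,3::nat}"
    "{..<4} - {2} = {0,1,3::nat}" "{..<4} - {3} = {0,1,2::nat}" by auto
  have f: "(\<Sum>r<4. g r) = g 0 + g 1 + g 2 + g 3" for g :: "nat \<Rightarrow> real"
    by (simp add: eval_nat_numeral)
  have s: "(\<Sum>r<4. \<Sum>s\<in>{..<4} - {r}. F r s) =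
      F 0 1 + F 1 0 + F 0 2 + F 2 0 + F 0 3 + F 3 0 + F 1 2 + F 2 1 + F 1 3 + F 3 1 + F 2 3 + F 3 2"
    for F :: "nat \<Rightarrow> nat \<Rightarrow> real"
    unfolding f d by simp
  have l: "length [i,j,k,l] = 4" by simp
  show ?thesis
    unfolding mc_mult_def hat_def contract_def l s
    by (simp only: numeral_2_eq_2 numeral_3_eq_3 One_nat_def list_update.simps nth_Cons_0 nth_Cons_Suc nat.case
        of_nat_numeral)
qed

text \<open>Pair symmetry gives \<open>X p s r q = X q r s p\<close>, so (r, s) and (s, r)
  contribute equally: the twelve terms collapse to six and the factor 1/4 becomes 1/2.\<close>

lemma mult_MC:
  assumes "X \<in> MC"
  shows "(X \<circledast> Y) i j k l = 1/2 *
     (contract (\<lambda>p q. X p i j q * Y p q k l) + contract (\<lambda>p q. X p i k q * Y p j q l)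
    + contract (\<lambda>p q. X p i l q * Y p j k q) + contract (\<lambda>p q. X p j k q * Y i p q l)
    + contract (\<lambda>p q. X p j l q * Y i p k q) + contract (\<lambda>p q. X p k l q * Y i j p q))"
proof -
  have "X p s r q = X q r s p" for p q r s
    using MC_pair[OF assms, of p s r q] MC_swap12[OF assms, of r q p s] MC_swap34[OF assms, of q r p s] by simp
  then have "contract (\<lambda>p q. X p s r q * F q p) = contract (\<lambda>p q. X p r s q * F p q)" for r s F
    by (subst contract_swap[symmetric]) metis
  from this[of _ _ "\<lambda>p q. Y p q k l"] this[of _ _ "\<lambda>p q. Y p j q l"] this[of _ _ "\<lambda>p q. Y p j k q"]
    this[of _ _ "\<lambda>p q. Y i p q l"] this[of _ _ "\<lambda>p q. Y i p k q"] this[of _ _ "\<lambda>p q. Y i j p q"]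
  show ?thesis unfolding mult_expand by simp
qed

lemma multilinear4_linear:
  assumes "multilinear4 Y"
  shows "linear (\<lambda>i. Y i j k l)" "linear (\<lambda>j. Y i j k l)" "linear (\<lambda>k. Y i j k l)" "linear (\<lambda>l. Y i j k l)"
  using assms unfolding multilinear4_def by blast+

lemma linear_cmult: "linear f \<Longrightarrow> linear (\<lambda>x. c * f x :: real)"
  and linear_multc: "linear f \<Longrightarrow> linear (\<lambda>x. f x * c :: real)"
  by (simp_all add: linear_iff algebra_simps)

lemma linear_contract:
  assumes "\<And>p q. linear (\<lambda>i. F i p q)"
  shows "linear (\<lambda>i. contract (F i))"
  unfolding contract_def by (intro linear_compose_sum ballI assms)

text \<open>The contraction \<open>X\<^sup>p\<^sub>r\<^sub>s\<^sup>q F\<^sub>p\<^sub>q\<close>.\<close>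

definition rcontract :: "('a::euclidean_space) form4 \<Rightarrow> 'a \<Rightarrow> 'a \<Rightarrow> ('a \<Rightarrow> 'a \<Rightarrow> real) \<Rightarrow> real" where
  "rcontract X r s F = contract (\<lambda>p q. X p r s q * F p q)"

lemma mult_rcontract:
  assumes "X \<in> MC"
  shows "(X \<circledast> Y) i j k l = 1/2 *
     (rcontract X i j (\<lambda>p q. Y p q k l) + rcontract X i k (\<lambda>p q. Y p j q l) + rcontract X i l (\<lambda>p q. Y p j k q)
    + rcontract X j k (\<lambda>p q. Y i p q l) + rcontract X j l (\<lambda>p q. Y i p k q) + rcontract X k l (\<lambda>p q. Y i j p q))"
  unfolding mult_MC[OF assms] rcontract_def ..

lemma rcontract_uminus: "(\<And>p q. F p q = - G p q) \<Longrightarrow> rcontract X r s F = - rcontract X r s G"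
  by (simp add: rcontract_def contract_uminus)

lemma rcontract_sum3:
  assumes "\<And>p q. F p q + G p q + H p q = 0"
  shows "rcontract X r s F + rcontract X r s G + rcontract X r s H = 0"
proof -
  have "X p r s q * F p q + X p r s q * G p q + X p r s q * H p q = 0" for p q
    using assms[of p q] by (metis distrib_left mult_zero_right)
  then show ?thesis by (simp add: rcontract_def contract_add[symmetric] contract_zero)
qed

lemma MC_outer_swap: "X \<in> MC \<Longrightarrow> X p s r q = X q r s p"
  using MC_pair[of X p s r q] MC_swap12[of X r q p s] MC_swap34[of X q r p s] by simp

lemma rcontract_swap:
  assumes "X \<in> MC" "\<And>p q. F p q = G q p"
  shows "rcontract X s r F = rcontract X r s G"
  unfolding rcontract_def assms(2)
  by (subst contract_swap[symmetric]) (metis MC_outer_swap[OF assms(1)])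

lemma linear_rcontract:
  assumes "X \<in> MC"
  shows "linear (\<lambda>r. rcontract X r s F)" "linear (\<lambda>s. rcontract X r s F)"
  unfolding rcontract_def
  by (intro linear_contract linear_multc multilinear4_linear MC_multilinear assms)+

lemma linear_rcontract_form: "(\<And>p q. linear (\<lambda>i. H i p q)) \<Longrightarrow> linear (\<lambda>i. rcontract X r s (H i))"
  unfolding rcontract_def by (intro linear_contract linear_cmult)

text \<open>A contraction is unchanged when the slots r, s and the summation indices p, q are
  exchanged together. The skew symmetries of \<open>Y\<close> therefore carry over: exchanging two
  free vectors permutes the six contractions and changes the sign of each.\<close>

lemma mult_in_MC:
  assumes X: "X \<in> MC" and Y: "Y \<in> MC"
  shows "X \<circledast> Y \<in> MC"
proof -
  note lin = multilinear4_linear[OF MC_multilinear[OF X]] multilinear4_linear[OF MC_multilinear[OF Y]]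
  have "multilinear4 (X \<circledast> Y)"
    unfolding multilinear4_def mult_rcontract[OF X]
    by (intro conjI allI linear_cmult linear_compose_add linear_rcontract linear_rcontract_form X lin)
  moreover have "(X \<circledast> Y) j i k l = - (X \<circledast> Y) i j k l" for i j k l
  proof -
    have "rcontract X j i (\<lambda>p q. Y p q k l) = rcontract X i j (\<lambda>p q. Y q p k l)"
      by (rule rcontract_swap[OF X refl])
    also have "\<dots> = - rcontract X i j (\<lambda>p q. Y p q k l)" by (intro rcontract_uminus MC_swap12 Y)
    finally have 1: "rcontract X j i (\<lambda>p q. Y p q k l) = - rcontract X i j (\<lambda>p q. Y p q k l)" .
    have 2: "rcontract X r s (\<lambda>p q. Y t p q l) = - rcontract X r s (\<lambda>p q. Y p t q l)"
      "rcontract X r s (\<lambda>p q. Y t p k q) = - rcontract X r s (\<lambda>p q. Y p t k q)"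
      "rcontract X r s (\<lambda>p q. Y j i p q) = - rcontract X r s (\<lambda>p q. Y i j p q)" for r s t
      by (intro rcontract_uminus MC_swap12 Y)+
    show ?thesis
      unfolding mult_rcontract[OF X]
      using 1 2(1)[of i k j] 2(1)[of j k i] 2(2)[of i l j] 2(2)[of j l i] 2(3)[of k l] by argo
  qed
  moreover have "(X \<circledast> Y) i j l k = - (X \<circledast> Y) i j k l" for i j k l
  proof -
    have "rcontract X l k (\<lambda>p q. Y i j p q) = rcontract X k l (\<lambda>p q. Y i j q p)"
      by (rule rcontract_swap[OF X refl])
    also have "\<dots> = - rcontract X k l (\<lambda>p q. Y i j p q)" by (intro rcontract_uminus MC_swap34 Y)
    finally have 1: "rcontract X l k (\<lambda>p q. Y i j p q) = - rcontract X k l (\<lambda>p q. Y i j p q)" .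
    have 2: "rcontract X r s (\<lambda>p q. Y i p q t) = - rcontract X r s (\<lambda>p q. Y i p t q)"
      "rcontract X r s (\<lambda>p q. Y p j q t) = - rcontract X r s (\<lambda>p q. Y p j t q)"
      "rcontract X r s (\<lambda>p q. Y p q l k) = - rcontract X r s (\<lambda>p q. Y p q k l)" for r s t
      by (intro rcontract_uminus MC_swap34 Y)+
    show ?thesis
      unfolding mult_rcontract[OF X]
      using 1 2(1)[of j k l] 2(1)[of j l k] 2(2)[of i k l] 2(2)[of i l k] 2(3)[of i j] by argo
  qed
  \<comment> \<open>In the cyclic sum, the nine contractions that involve l form three groups in
    which \<open>Y\<close> satisfies Bianchi (fact 1). The other nine do the same (fact 3) after
    fact 2 has aligned the order of the contracted pair.\<close>
  moreover have "(X \<circledast> Y) i j k l + (X \<circledast> Y) j k i l + (X \<circledast> Y) k i j l = 0" for i j k l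
  proof -
    note B = MC_bianchi[OF Y]
    have 1: "rcontract X r l (\<lambda>p q. Y p s t q) + rcontract X r l (\<lambda>p q. Y s t p q) + rcontract X r l (\<lambda>p q. Y t p s q) = 0" for r s t
      by (intro rcontract_sum3 B)
    have 2: "rcontract X s r (\<lambda>p q. Y p t q l) = rcontract X r s (\<lambda>p q. Y q t p l)" for r s t
      by (rule rcontract_swap[OF X refl])
    have 3: "rcontract X r s (\<lambda>p q. Y p q t l) + rcontract X r s (\<lambda>p q. Y q t p l) + rcontract X r s (\<lambda>p q. Y t p q l) = 0" for r s t
      by (intro rcontract_sum3 B)
    show ?thesis
      unfolding mult_rcontract[OF X] using 1[of i j k] 1[of j k i] 1[of k i j] 3[of i j k] 3[of j k i] 3[of k i j]
      2[of i k j] 2[of j i k] 2[of k j i]  by argo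
  qed
  ultimately show ?thesis unfolding mem_MC_iff by blast
qed

text \<open>Tracing the outer slots leaves six triple sums. Two of them contain a Ricci trace of
  \<open>X\<close> or of \<open>Y\<close> and vanish; the other four cancel in pairs after a cyclic
  renaming of the summation indices.\<close>

lemma ricci_mult:
  assumes X: "X \<in> MC_W" and Y: "Y \<in> MC_W"
  shows "ricci (X \<circledast> Y) = 0"
proof (intro ext)
  fix j k
  have XM: "X \<in> MC" and YM: "Y \<in> MC" using X Y by (auto simp: MC_W_def)
  have r0: "(\<Sum>p\<in>Basis. Z p i j p) = 0" if "Z \<in> MC_W" for Z :: "'a form4" and i j
    using that by (simp add: MC_W_def ricci_def fun_eq_iff)
  define S where "S F = (\<Sum>i\<in>Basis. \<Sum>p\<in>Basis. \<Sum>q\<in>Basis. F i p q)" for F :: "'a \<Rightarrow> 'a \<Rightarrow> 'a \<Rightarrow> real"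
  have S_cyc: "S (\<lambda>i p q. F p q i) = S F" for F
  proof -
    have "S (\<lambda>i p q. F p q i) = (\<Sum>p\<in>Basis. \<Sum>i\<in>Basis. \<Sum>q\<in>Basis. F p q i)"
      unfolding S_def by (rule sum.swap)
    also have "\<dots> = S F" unfolding S_def by (rule sum.cong[OF refl], rule sum.swap)
    finally show ?thesis .
  qed
  have S_neg: "S F = - S G" if "\<And>i p q. F i p q = - G q i p" for F G
    using S_cyc[of "\<lambda>i p q. G q i p"] unfolding S_def that by (simp add: sum_negf)
  \<comment> \<open>Pair symmetry followed by one skew symmetry; this is the source of the sign in
    facts 1 and 2.\<close>
  have sw: "X p s t q = - X t q s p" for p q s t
    using MC_pair[OF XM, of s p t q] MC_swap12[OF XM, of s p t q] by simp
  have 1: "S (\<lambda>i p q. X p j i q * Y i p k q) = - S (\<lambda>i p q. X p i j q * Y p q k i)"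
    by (intro S_neg) (subst sw, simp)
  have 2: "S (\<lambda>i p q. X p k i q * Y i j p q) = - S (\<lambda>i p q. X p i k q * Y p j q i)"
    by (intro S_neg) (subst sw, simp)
  have S_zero: "S F = 0" if "\<And>p q. (\<Sum>i\<in>Basis. F i p q) = 0" for F
    using S_cyc[of "\<lambda>i p q. F q i p"] by (simp add: S_def that)
  have 3: "S (\<lambda>i p q. X p i i q * Y p j k q) = 0"
  proof (rule S_zero)
    show "(\<Sum>i\<in>Basis. X p i i q * Y p j k q) = 0" for p q
      using r0[OF X, of q p] MC_pair[OF XM, of _ q p _]
      by (simp add: sum_distrib_right[symmetric])
  qed
  have 4: "S (\<lambda>i p q. X p j k q * Y i p q i) = 0"
    by (intro S_zero) (simp add: sum_distrib_left[symmetric] r0[OF Y])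
  have "ricci (X \<circledast> Y) j k = 1/2 * (S (\<lambda>i p q. X p i j q * Y p q k i) + S (\<lambda>i p q. X p i k q * Y p j q i)
     + S (\<lambda>i p q. X p i i q * Y p j k q) + S (\<lambda>i p q. X p j k q * Y i p q i)
     + S (\<lambda>i p q. X p j i q * Y i p k q) + S (\<lambda>i p q. X p k i q * Y i j p q))"
    unfolding ricci_def mult_MC[OF XM] S_def contract_def
    by (simp add: sum.distrib sum_divide_distrib[symmetric])
  then show "ricci (X \<circledast> Y) j k = 0 j k" unfolding 1 2 3 4 by simp
qed

lemma mult_W_W: "X \<in> MC_W \<Longrightarrow> Y \<in> MC_W \<Longrightarrow> X \<circledast> Y \<in> MC_W"
  using ricci_mult[of X Y] mult_in_MC[of X Y] by (simp add: MC_W_def)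

subsection \<open>Products with trace tensors\<close>

lemma sym_formsD: "\<alpha> \<in> sym_forms \<Longrightarrow> bilinear \<alpha>" "\<alpha> \<in> sym_forms \<Longrightarrow> \<alpha> i j = \<alpha> j i"
  unfolding sym_forms_def by blast+

lemma inner_in_sym_forms: "inner \<in> sym_forms"
  by (simp add: sym_forms_def bilinear_def linear_iff inner_left_distrib inner_right_distrib inner_commute)

lemma curlywedge_in_MC:
  assumes "\<alpha> \<in> sym_forms" "\<beta> \<in> sym_forms"
  shows "curlywedge \<alpha> \<beta> \<in> MC"
proof -
  have lin: "linear (\<lambda>i. \<alpha> i j)" "linear (\<lambda>i. \<alpha> j i)" "linear (\<lambda>i. \<beta> i j)" "linear (\<lambda>i. \<beta> j i)" for j
    using assms sym_formsD(1) unfolding bilinear_def by blast+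
  have s: "\<alpha> k i = \<alpha> i k" "\<beta> k i = \<beta> i k" for i k using assms sym_formsD(2) by blast+
  have "multilinear4 (curlywedge \<alpha> \<beta>)"
    unfolding multilinear4_def curlywedge_def
    by (intro conjI allI linear_compose_sub linear_cmult linear_multc lin)
  moreover have "curlywedge \<alpha> \<beta> i j k l + curlywedge \<alpha> \<beta> j k i l + curlywedge \<alpha> \<beta> k i j l = 0" for i j k l
    unfolding curlywedge_def using s(1)[of k j] s(1)[of k i] s(1)[of j i] s(2)[of k j] s(2)[of k i] s(2)[of j i]
    by (simp only:) argo
  moreover have "curlywedge \<alpha> \<beta> j i k l = - curlywedge \<alpha> \<beta> i j k l"
       "curlywedge \<alpha> \<beta> i j l k = - curlywedge \<alpha> \<beta> i j k l" for i j k l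
    unfolding curlywedge_def by argo+
  ultimately show ?thesis unfolding mem_MC_iff by blast
qed

lemma sum_Basis_inner_linear:
  fixes f :: "'a::euclidean_space \<Rightarrow> real"
  assumes "linear f"
  shows "(\<Sum>p\<in>Basis. f p * (p \<bullet> v)) = f v"
proof -
  have "f v = f (\<Sum>p\<in>Basis. (v \<bullet> p) *\<^sub>R p)" by (simp add: euclidean_representation)
  also have "\<dots> = (\<Sum>p\<in>Basis. (v \<bullet> p) * f p)" by (simp add: linear_sum[OF assms] linear_cmul[OF assms])
  finally show ?thesis by (simp add: inner_commute mult.commute)
qed

lemma rcontract_add: "rcontract X r s (\<lambda>p q. F p q + G p q) = rcontract X r s F + rcontract X r s G"
  and rcontract_diff: "rcontract X r s (\<lambda>p q. F p q - G p q) = rcontract X r s F - rcontract X r s G"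
  and rcontract_cmult: "rcontract X r s (\<lambda>p q. c * F p q) = c * rcontract X r s F"
  and rcontract_multc: "rcontract X r s (\<lambda>p q. F p q * c) = rcontract X r s F * c"
  by (simp_all add: rcontract_def algebra_simps contract_add contract_diff contract_cmult)

lemma rcontract_inner: "rcontract X r s inner = ricci X r s"
  unfolding rcontract_def contract_def ricci_def
  by (simp add: inner_Basis if_distrib[of "\<lambda>x. _ * x"] cong: if_cong)

text \<open>Contracting with a product of two covectors is evaluation in the outer slots. The
  product formulas below are computed through this rule, without handling sums.\<close>

lemma rcontract_vectors:
  assumes "X \<in> MC"
  shows "rcontract X r s (\<lambda>p q. (p \<bullet> u) * (q \<bullet> v)) = X u r s v"
proof -
  note lin = multilinear4_linear[OF MC_multilinear[OF assms]]
  have "rcontract X r s (\<lambda>p q. (p \<bullet> u) * (q \<bullet> v)) = (\<Sum>p\<in>Basis. (\<Sum>q\<in>Basis. X p r s q * (q \<bullet> v)) * (p \<bullet> u))"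
    unfolding rcontract_def contract_def by (simp add: sum_distrib_left sum_distrib_right mult_ac)
  then show ?thesis by (simp add: sum_Basis_inner_linear lin)
qed

lemma ricci_commute: "X \<in> MC \<Longrightarrow> ricci X i j = ricci X j i"
  unfolding ricci_def by (subst MC_outer_swap) simp_all

text \<open>On symmetric \<open>\<alpha>\<close> this is the paper's endomorphism for \<open>k = 2\<close>, whose two summands then agree.\<close>

definition hat2 :: "('a::euclidean_space) form4 \<Rightarrow> ('a \<Rightarrow> 'a \<Rightarrow> real) \<Rightarrow> 'a \<Rightarrow> 'a \<Rightarrow> real" where
  "hat2 X \<alpha> r s = rcontract X r s \<alpha>"

lemma hat2_inner: "hat2 X inner = ricci X"
  by (simp add: hat2_def rcontract_inner fun_eq_iff)

text \<open>Writing \<alpha> through a map \<open>A\<close> turns a slot of \<alpha> into an inner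
  product, so that \<open>rcontract_vectors\<close> applies to it.\<close>

lemma bilinear_repr:
  fixes \<alpha> :: "'a::euclidean_space \<Rightarrow> 'a \<Rightarrow> real"
  assumes "bilinear \<alpha>"
  obtains A where "\<And>x y. \<alpha> x y = x \<bullet> A y"
proof
  fix x y
  have "linear (\<lambda>x. \<alpha> x y)" using assms by (simp add: bilinear_def)
  from sum_Basis_inner_linear[OF this, of x]
  show "\<alpha> x y = x \<bullet> (\<Sum>p\<in>Basis. \<alpha> p y *\<^sub>R p)"
    by (simp add: inner_sum_right inner_commute)
qed

text \<open>Where both contracted slots fall on the same factor, the contraction yields
  \<open>ricci X\<close> (on h) or \<open>hat2 X \<alpha>\<close> (on \<alpha>), and these terms
  assemble into the two wedges. The mixed terms evaluate \<open>X\<close> at one of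
  \<open>A i\<close>, \<open>A j\<close>, \<open>A k\<close>, \<open>A l\<close> and must
  cancel.\<close>

lemma mult_wedge:
  assumes X: "X \<in> MC" and \<alpha>: "\<alpha> \<in> sym_forms"
  shows "(X \<circledast> curlywedge inner \<alpha>) i j k l =
    1/2 * (curlywedge (ricci X) \<alpha> i j k l + curlywedge inner (hat2 X \<alpha>) i j k l)"
proof -
  obtain A where A: "\<And>x y. \<alpha> x y = x \<bullet> A y" using bilinear_repr sym_formsD(1)[OF \<alpha>] by blast
  have s: "\<alpha> x y = y \<bullet> A x" for x y using A sym_formsD(2)[OF \<alpha>] by metis
  note rcontract_simps = rcontract_diff rcontract_cmult rcontract_multc rcontract_vectors[OF X] rcontract_inner hat2_def[of X \<alpha>, symmetric]
  let ?W = "curlywedge inner \<alpha>"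
  have 12: "rcontract X i j (\<lambda>p q. ?W p q k l) =
     1/2 * (X k i j (A l) - X (A l) i j k) - 1/2 * (X l i j (A k) - X (A k) i j l)"
  proof -
    have "(\<lambda>p q. ?W p q k l) = (\<lambda>p q. 1/2 * ((p \<bullet> k) * (q \<bullet> A l) - (p \<bullet> A l) * (q \<bullet> k))
       - 1/2 * ((p \<bullet> l) * (q \<bullet> A k) - (p \<bullet> A k) * (q \<bullet> l)))"
      by (intro ext) (simp add: curlywedge_def A inner_commute mult.commute)
    then show ?thesis by (simp only: rcontract_simps)
  qed
  have 13: "rcontract X i k (\<lambda>p q. ?W p j q l) =
     1/2 * (ricci X i k * \<alpha> j l - X (A l) i k j) - 1/2 * (X l i k (A j) - (l \<bullet> j) * hat2 X \<alpha> i k)"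
  proof -
    have "(\<lambda>p q. ?W p j q l) = (\<lambda>p q. 1/2 * ((p \<bullet> q) * \<alpha> j l - (p \<bullet> A l) * (q \<bullet> j))
       - 1/2 * ((p \<bullet> l) * (q \<bullet> A j) - (l \<bullet> j) * \<alpha> p q))"
      by (intro ext) (simp add: curlywedge_def A[of _ l] s[of j] inner_commute mult.commute)
    then show ?thesis by (simp only: rcontract_simps)
  qed
  have 14: "rcontract X i l (\<lambda>p q. ?W p j k q) =
     1/2 * (X k i l (A j) - (k \<bullet> j) * hat2 X \<alpha> i l) - 1/2 * (ricci X i l * \<alpha> j k - X (A k) i l j)"
  proof -
    have "(\<lambda>p q. ?W p j k q) = (\<lambda>p q. 1/2 * ((p \<bullet> k) * (q \<bullet> A j) - (k \<bullet> j) * \<alpha> p q)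
       - 1/2 * ((p \<bullet> q) * \<alpha> j k - (p \<bullet> A k) * (q \<bullet> j)))"
      by (intro ext) (simp add: curlywedge_def A[of _ k] s[of j] inner_commute mult.commute)
    then show ?thesis by (simp only: rcontract_simps)
  qed
  have 23: "rcontract X j k (\<lambda>p q. ?W i p q l) =
     1/2 * (X (A l) j k i - ricci X j k * \<alpha> i l) - 1/2 * ((l \<bullet> i) * hat2 X \<alpha> j k - X l j k (A i))"
  proof -
    have "(\<lambda>p q. ?W i p q l) = (\<lambda>p q. 1/2 * ((p \<bullet> A l) * (q \<bullet> i) - (p \<bullet> q) * \<alpha> i l)
       - 1/2 * ((l \<bullet> i) * \<alpha> p q - (p \<bullet> l) * (q \<bullet> A i)))"
      by (intro ext) (simp add: curlywedge_def A[of _ l] s[of i] inner_commute mult.commute)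
    then show ?thesis by (simp only: rcontract_simps)
  qed
  have 24: "rcontract X j l (\<lambda>p q. ?W i p k q) =
     1/2 * ((k \<bullet> i) * hat2 X \<alpha> j l - X k j l (A i)) - 1/2 * (X (A k) j l i - ricci X j l * \<alpha> i k)"
  proof -
    have "(\<lambda>p q. ?W i p k q) = (\<lambda>p q. 1/2 * ((k \<bullet> i) * \<alpha> p q - (p \<bullet> k) * (q \<bullet> A i))
       - 1/2 * ((p \<bullet> A k) * (q \<bullet> i) - (p \<bullet> q) * \<alpha> i k))"
      by (intro ext) (simp add: curlywedge_def A[of _ k] s[of i] inner_commute mult.commute)
    then show ?thesis by (simp only: rcontract_simps)
  qed
  have 34: "rcontract X k l (\<lambda>p q. ?W i j p q) =
     1/2 * (X i k l (A j) - X j k l (A i)) - 1/2 * (X (A j) k l i - X (A i) k l j)"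
  proof -
    have "(\<lambda>p q. ?W i j p q) = (\<lambda>p q. 1/2 * ((p \<bullet> i) * (q \<bullet> A j) - (p \<bullet> j) * (q \<bullet> A i))
       - 1/2 * ((p \<bullet> A j) * (q \<bullet> i) - (p \<bullet> A i) * (q \<bullet> j)))"
      by (intro ext) (simp add: curlywedge_def s inner_commute mult.commute)
    then show ?thesis by (simp only: rcontract_simps)
  qed
  \<comment> \<open>The mixed terms cancel separately for each vector to which \<open>A\<close> is
    applied, with \<open>L\<close> in its place: \<open>z\<close> serves \<open>A l\<close> and
    \<open>A k\<close>, \<open>z2\<close> serves \<open>A j\<close> and \<open>A i\<close>. Pair
    symmetry and skewness suffice.\<close>
  have z: "X a b c L - X L b c a - X L b a c + X L c a b = 0" for a b c L
    using MC_outer_swap[OF X, of L b c a] MC_outer_swap[OF X, of L b a c] MC_outer_swap[OF X, of L c a b]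
      MC_swap12[OF X, of a b c L] MC_swap12[OF X, of a c b L] by simp
  have z2: "X a b c L + X b a c L - X c b a L - X L a c b = 0" for a b c L
    using MC_outer_swap[OF X, of L a c b] MC_swap12[OF X, of a b c L] MC_swap12[OF X, of c b a L] by simp
  show ?thesis
    unfolding mult_rcontract[OF X] 12 13 14 23 24 34
    unfolding curlywedge_def ricci_commute[OF X, of k i] ricci_commute[OF X, of k j] ricci_commute[OF X, of l i] ricci_commute[OF X, of l j]
    using z[of k i j "A l"] z[of l i j "A k"] z2[of k i l "A j"] z2[of k j l "A i"] by argo
qed

text \<open>This provides the scalars behind the dimension bounds: the trace acts on trace-free
  \<alpha> as (2 - n)/2 and on the metric as 1 - n, where n is the dimension.\<close>

lemma ricci_wedge:
  fixes \<alpha> :: "'a::euclidean_space \<Rightarrow> 'a \<Rightarrow> real"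
  assumes "\<alpha> \<in> sym_forms"
  shows "ricci (curlywedge inner \<alpha>) i j = 1/2 * ((2 - real DIM('a)) * \<alpha> i j - trace_form \<alpha> * (i \<bullet> j))"
proof -
  obtain A where A: "\<And>x y. \<alpha> x y = x \<bullet> A y" using bilinear_repr sym_formsD(1)[OF assms] by blast
  have s: "\<alpha> x y = y \<bullet> A x" for x y using A sym_formsD(2)[OF assms] by metis
  have 1: "(\<Sum>p\<in>Basis. (p \<bullet> v) * (p \<bullet> w)) = v \<bullet> w" for v w :: 'a
    by (simp add: euclidean_inner[of v w] inner_commute)
  have "curlywedge inner \<alpha> p i j p = 1/2 * ((p \<bullet> j) * (p \<bullet> A i) - (i \<bullet> j) * \<alpha> p p)
      - 1/2 * ((p \<bullet> p) * \<alpha> i j - (p \<bullet> i) * (p \<bullet> A j))" for p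
    by (simp add: curlywedge_def s[of i p] A[of p j] inner_commute)
  then have "ricci (curlywedge inner \<alpha>) i j = (\<Sum>p\<in>Basis. 1/2 * ((p \<bullet> j) * (p \<bullet> A i) - (i \<bullet> j) * \<alpha> p p)
      - 1/2 * ((p \<bullet> p) * \<alpha> i j - (p \<bullet> i) * (p \<bullet> A j)))"
    unfolding ricci_def by simp
  also have "\<dots> = 1/2 * (j \<bullet> A i - (i \<bullet> j) * trace_form \<alpha>) - 1/2 * (real DIM('a) * \<alpha> i j - i \<bullet> A j)"
    by (simp add: sum_subtractf 1 trace_form_def inner_same_Basis
        flip: sum_distrib_left sum_distrib_right sum_divide_distrib)
  also have "\<dots> = 1/2 * ((2 - real DIM('a)) * \<alpha> i j - trace_form \<alpha> * (i \<bullet> j))"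
    using s[of i j] A[of i j] by (simp add: field_simps)
  finally show ?thesis .
qed

subsection \<open>Bilinearity and orthogonal projection\<close>

lemma scaleR_fun_apply [simp]: "(r *\<^sub>R f) x = r *\<^sub>R f x"
  by (simp add: scaleR_fun_def)

lemma mult_add_left: "(X + X') \<circledast> Y = X \<circledast> Y + X' \<circledast> Y"
  and mult_add_right: "X \<circledast> (Y + Y') = X \<circledast> Y + X \<circledast> Y'"
  and mult_diff_left: "(X - X') \<circledast> Y = X \<circledast> Y - X' \<circledast> Y"
  and mult_diff_right: "X \<circledast> (Y - Y') = X \<circledast> Y - X \<circledast> Y'"
  by (intro ext; simp only: mult_expand plus_fun_apply minus_apply distrib_left distrib_right
        left_diff_distrib right_diff_distrib contract_add contract_diff; argo)+

lemma mult_scaleR_left: "(c *\<^sub>R X) \<circledast> Y = c *\<^sub>R (X \<circledast> Y)"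
  and mult_scaleR_right: "X \<circledast> (c *\<^sub>R Y) = c *\<^sub>R (X \<circledast> Y)"
  by (intro ext; simp only: mult_expand scaleR_fun_apply real_scaleR_def mult.assoc mult.left_commute[of _ c] contract_cmult;
      simp add: algebra_simps)+

lemma form_inner_add_left: "form_inner (X + X') Y = form_inner X Y + form_inner X' Y"
  and form_inner_diff_left: "form_inner (X - X') Y = form_inner X Y - form_inner X' Y"
  and form_inner_scaleR_left: "form_inner (c *\<^sub>R X) Y = c * form_inner X Y"
  by (simp_all add: form_inner_def algebra_simps sum.distrib sum_subtractf sum_distrib_left)

lemma form_inner_commute: "form_inner X Y = form_inner Y X"
  by (simp add: form_inner_def mult.commute)

lemma form_inner_add_right: "form_inner X (Y + Y') = form_inner X Y + form_inner X Y'"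
  and form_inner_diff_right: "form_inner X (Y - Y') = form_inner X Y - form_inner X Y'"
  and form_inner_scaleR_right: "form_inner X (c *\<^sub>R Y) = c * form_inner X Y"
  by (simp_all only: form_inner_commute[of X] form_inner_add_left form_inner_diff_left form_inner_scaleR_left)

lemma form_inner_zero_left: "form_inner 0 Y = 0"
  and form_inner_zero_right: "form_inner X 0 = 0"
  by (simp_all add: form_inner_def)

section \<open>Definiteness of the inner product, and projection onto finite spans\<close>

lemma linear_eq_0_Basis:
  fixes f :: "'a::euclidean_space \<Rightarrow> real"
  assumes "linear f" "\<And>b. b \<in> Basis \<Longrightarrow> f b = 0"
  shows "f x = 0"
  using sum_Basis_inner_linear[OF assms(1), of x] assms(2) by simp

lemma multilinear4_eq_0:
  assumes "multilinear4 Y"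
    and "\<And>i j k l. i \<in> Basis \<Longrightarrow> j \<in> Basis \<Longrightarrow> k \<in> Basis \<Longrightarrow> l \<in> Basis \<Longrightarrow> Y i j k l = 0"
  shows "Y = 0"
proof (intro ext)
  fix i j k l
  have 1: "Y i j k l = 0" if "i \<in> Basis" "j \<in> Basis" "k \<in> Basis" for i j k l
    using linear_eq_0_Basis[OF multilinear4_linear(4)[OF assms(1)], of i j k l] assms(2) that by simp
  have 2: "Y i j k l = 0" if "i \<in> Basis" "j \<in> Basis" for i j k l
    using linear_eq_0_Basis[OF multilinear4_linear(3)[OF assms(1)], of i j l k] 1 that by simp
  have 3: "Y i j k l = 0" if "i \<in> Basis" for i j k l
    using linear_eq_0_Basis[OF multilinear4_linear(2)[OF assms(1)], of i k l j] 2 that by simp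
  show "Y i j k l = 0 i j k l"
    using linear_eq_0_Basis[OF multilinear4_linear(1)[OF assms(1)], of j k l i] 3 by simp
qed

lemma form_inner_eq_0:
  assumes "X \<in> MC" "form_inner X X = 0"
  shows "X = 0"
proof (rule multilinear4_eq_0[OF MC_multilinear[OF assms(1)]])
  show "X i j k l = 0" if "i \<in> Basis" "j \<in> Basis" "k \<in> Basis" "l \<in> Basis" for i j k l
    using assms(2) that unfolding form_inner_def
    by (simp add: sum_nonneg_eq_0_iff sum_nonneg)
qed

lemma subspace_MC: "subspace MC"
proof (rule subspaceI)
  show "0 \<in> (MC :: 'a form4 set)" by (simp add: mem_MC_iff multilinear4_def linear_zero)
  fix X Y :: "'a form4" assume X: "X \<in> MC" and Y: "Y \<in> MC"
  have "multilinear4 (X + Y)"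
    using MC_multilinear[OF X] MC_multilinear[OF Y] by (simp add: multilinear4_def linear_compose_add)
  moreover have "(X + Y) j i k l = - (X + Y) i j k l" "(X + Y) i j l k = - (X + Y) i j k l" for i j k l
    using MC_swap12[OF X, of j i k l] MC_swap12[OF Y, of j i k l]
      MC_swap34[OF X, of i j l k] MC_swap34[OF Y, of i j l k] unfolding plus_fun_apply by linarith+
  moreover have "(X + Y) i j k l + (X + Y) j k i l + (X + Y) k i j l = 0" for i j k l
    using MC_bianchi[OF X, of i j k l] MC_bianchi[OF Y, of i j k l] unfolding plus_fun_apply by linarith
  ultimately show "X + Y \<in> MC" unfolding mem_MC_iff by blast
next
  fix X :: "'a form4" and c assume X: "X \<in> MC"
  have "multilinear4 (c *\<^sub>R X)"
    using MC_multilinear[OF X] by (simp add: multilinear4_def linear_cmult)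
  moreover have "(c *\<^sub>R X) j i k l = - (c *\<^sub>R X) i j k l" "(c *\<^sub>R X) i j l k = - (c *\<^sub>R X) i j k l" for i j k l
    using MC_swap12[OF X, of j i k l] MC_swap34[OF X, of i j l k] unfolding scaleR_fun_apply real_scaleR_def by simp_all
  moreover have "(c *\<^sub>R X) i j k l + (c *\<^sub>R X) j k i l + (c *\<^sub>R X) k i j l = 0" for i j k l
    by (simp only: scaleR_fun_apply real_scaleR_def distrib_left[symmetric] MC_bianchi[OF X] mult_zero_right)
  ultimately show "c *\<^sub>R X \<in> MC" unfolding mem_MC_iff by blast
qed

lemma ricci_add: "ricci (X + Y) = ricci X + ricci Y"
  and ricci_diff: "ricci (X - Y) = ricci X - ricci Y"
  and ricci_scaleR: "ricci (c *\<^sub>R X) = c *\<^sub>R ricci X"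
  by (simp_all add: fun_eq_iff ricci_def sum.distrib sum_subtractf sum_distrib_left)

lemma subspace_MC_W: "subspace MC_W"
proof -
  have "ricci (0 :: 'a form4) = 0" by (simp add: fun_eq_iff ricci_def)
  then show ?thesis using subspace_MC[where 'a='a] unfolding subspace_def MC_W_def
    by (simp add: ricci_add ricci_scaleR)
qed

lemma form_inner_span:
  assumes "\<And>s. s \<in> S \<Longrightarrow> form_inner x s = 0" "y \<in> span S"
  shows "form_inner x y = 0"
proof -
  have "subspace {y. form_inner x y = 0}"
    by (auto simp: subspace_def form_inner_add_right form_inner_scaleR_right)
      (simp add: form_inner_def)
  then show ?thesis using span_minimal[of S "{y. form_inner x y = 0}"] assms by auto
qed

text \<open>One Gram-Schmidt step per generator: the component \<open>t\<close> of the new generator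
  orthogonal to the old span corrects the old projection. The generators and \<open>x\<close> must
  lie in \<open>MC\<close>, because \<open>form_inner\<close> only sees values on
  \<open>Basis\<close> and is definite only on multilinear functions.\<close>

lemma orthogonal_projection_span:
  assumes "finite S" "S \<subseteq> MC" "x \<in> MC"
  shows "\<exists>w\<in>span S. \<forall>s\<in>S. form_inner (x - w) s = 0"
  using assms
proof (induction S arbitrary: x)
  case empty
  then show ?case by (auto intro: span_zero)
next
  case (insert s S)
  obtain s0 where s0: "s0 \<in> span S" "\<And>r. r \<in> S \<Longrightarrow> form_inner (s - s0) r = 0"
    using insert.IH[of s] insert.prems by blast
  obtain w where w: "w \<in> span S" "\<And>r. r \<in> S \<Longrightarrow> form_inner (x - w) r = 0"
    using insert.IH[of x] insert.prems by blast
  define t where "t = s - s0"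
  have "span S \<subseteq> MC" using span_minimal[OF _ subspace_MC] insert.prems by auto
  then have "t \<in> MC"
    using insert.prems s0(1) subspace_diff[OF subspace_MC] by (auto simp: t_def)
  define c where "c = form_inner (x - w) t / form_inner t t"
  \<comment> \<open>If the new generator already lies in the old span, then \<open>t\<close> is 0
    and division by zero makes \<open>c\<close> equal to 0; the equation still holds.\<close>
  have c: "c * form_inner t t = form_inner (x - w) t"
  proof (cases "form_inner t t = 0")
    case True
    then have "t = 0" using form_inner_eq_0 \<open>t \<in> MC\<close> by blast
    then show ?thesis by (simp add: form_inner_zero_left form_inner_zero_right)
  qed (simp add: c_def)
  let ?w = "w + c *\<^sub>R t"
  have S: "form_inner (x - ?w) r = 0" if "r \<in> S" for r
    using w(2)[OF that] s0(2)[OF that]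
    by (simp add: form_inner_add_left form_inner_diff_left form_inner_scaleR_left t_def)
  have "form_inner (x - ?w) t = 0"
    using c by (simp add: form_inner_add_left form_inner_diff_left form_inner_scaleR_left)
  moreover have "form_inner (x - ?w) s0 = 0" by (rule form_inner_span[OF S s0(1)])
  ultimately have "form_inner (x - ?w) s = 0" by (simp add: t_def form_inner_diff_right)
  moreover have "t \<in> span (insert s S)" "w \<in> span (insert s S)"
    unfolding t_def using s0(1) w(1) span_mono[OF subset_insertI, of S s]
    by (auto intro!: span_diff intro: span_base)
  then have "?w \<in> span (insert s S)" by (intro span_add span_scale)
  ultimately show ?case using S by blast
qed

subsection \<open>Squares of bivectors\<close>

text \<open>The tensor square of the bivector a \<and> b.\<close>

definition biv :: "'a \<Rightarrow> 'a \<Rightarrow> ('a::euclidean_space) form4" where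
  "biv a b i j k l = ((a \<bullet> i) * (b \<bullet> j) - (b \<bullet> i) * (a \<bullet> j)) * ((a \<bullet> k) * (b \<bullet> l) - (b \<bullet> k) * (a \<bullet> l))"

lemma biv_commute: "biv b a = biv a b"
  unfolding biv_def by (intro ext) (simp add: algebra_simps)

lemma linear_inner_right: "linear ((\<bullet>) a)"
  by (rule bounded_linear.linear[OF bounded_linear_inner_right])

text \<open>The Bianchi identity is the Pluecker relation of the decomposable bivector a \<and>
  b.\<close>

lemma biv_in_MC: "biv a b \<in> MC"
proof -
  have "multilinear4 (biv a b)"
    unfolding multilinear4_def biv_def
    by (intro conjI allI linear_cmult linear_multc linear_compose_sub linear_inner_right)
  then show ?thesis unfolding mem_MC_iff biv_def by (auto simp: algebra_simps)
qed

text \<open>The trace is minus the projection form of the plane spanned by \<open>a\<close> and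
  \<open>b\<close>. Hence the sums over any two perfect matchings of four orthonormal vectors have
  the same trace, and their difference is a Weyl tensor.\<close>

lemma ricci_biv:
  assumes "a \<bullet> a = 1" "b \<bullet> b = 1" "a \<bullet> b = 0"
  shows "ricci (biv a b) i j = - ((a \<bullet> i) * (a \<bullet> j) + (b \<bullet> i) * (b \<bullet> j))"
proof -
  have 1: "(\<Sum>p\<in>Basis. (v \<bullet> p) * (w \<bullet> p)) = v \<bullet> w" for v w :: 'a
    by (simp add: euclidean_inner[of v w])
  have "ricci (biv a b) i j = (\<Sum>p\<in>Basis. ((a \<bullet> p) * (b \<bullet> p)) * ((b \<bullet> i) * (a \<bullet> j)) - ((a \<bullet> p) * (a \<bullet> p)) * ((b \<bullet> i) * (b \<bullet> j))
     - ((b \<bullet> p) * (b \<bullet> p)) * ((a \<bullet> i) * (a \<bullet> j)) + ((b \<bullet> p) * (a \<bullet> p)) * ((a \<bullet> i) * (b \<bullet> j)))"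
    unfolding ricci_def biv_def by (intro sum.cong refl) (simp add: algebra_simps)
  also have "\<dots> = - ((a \<bullet> i) * (a \<bullet> j) + (b \<bullet> i) * (b \<bullet> j))"
    by (simp add: sum.distrib sum_subtractf 1 assms inner_commute[of b a] flip: sum_distrib_right)
  finally show ?thesis .
qed

text \<open>Each slot of \<open>biv c d\<close> is an inner product with \<open>c\<close> or
  \<open>d\<close>, so only the values of \<open>X\<close> with \<open>c\<close> or \<open>d\<close>
  in both outer slots enter. The multiplication rules below follow by substituting these
  values.\<close>

lemma mult_biv:
  assumes X: "X \<in> MC"
  shows "(X \<circledast> biv c d) i j k l = 1/2 *
   ((X c i j d - X d i j c) * ((c \<bullet> k) * (d \<bullet> l) - (d \<bullet> k) * (c \<bullet> l))
  + (X c i k c * ((d \<bullet> j) * (d \<bullet> l)) - X c i k d * ((d \<bullet> j) * (c \<bullet> l)) - X d i k c * ((c \<bullet> j) * (d \<bullet> l)) + X d i k d * ((c \<bullet> j) * (c \<bullet> l)))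
  - (X c i l c * ((d \<bullet> j) * (d \<bullet> k)) - X c i l d * ((d \<bullet> j) * (c \<bullet> k)) - X d i l c * ((c \<bullet> j) * (d \<bullet> k)) + X d i l d * ((c \<bullet> j) * (c \<bullet> k)))
  - (X c j k c * ((d \<bullet> i) * (d \<bullet> l)) - X c j k d * ((d \<bullet> i) * (c \<bullet> l)) - X d j k c * ((c \<bullet> i) * (d \<bullet> l)) + X d j k d * ((c \<bullet> i) * (c \<bullet> l)))
  + (X c j l c * ((d \<bullet> i) * (d \<bullet> k)) - X c j l d * ((d \<bullet> i) * (c \<bullet> k)) - X d j l c * ((c \<bullet> i) * (d \<bullet> k)) + X d j l d * ((c \<bullet> i) * (c \<bullet> k)))
  + (X c k l d - X d k l c) * ((c \<bullet> i) * (d \<bullet> j) - (d \<bullet> i) * (c \<bullet> j)))"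
proof -
  have 1: "rcontract X r s (\<lambda>p q. ((p \<bullet> c) * (q \<bullet> d) - (p \<bullet> d) * (q \<bullet> c)) * t) = (X c r s d - X d r s c) * t" for r s t
    by (simp only: rcontract_diff rcontract_multc rcontract_vectors[OF X])
  have 2: "rcontract X r s (\<lambda>p q. ((p \<bullet> c) * (q \<bullet> c)) * ((d \<bullet> u) * (d \<bullet> v)) - ((p \<bullet> c) * (q \<bullet> d)) * ((d \<bullet> u) * (c \<bullet> v))
       - ((p \<bullet> d) * (q \<bullet> c)) * ((c \<bullet> u) * (d \<bullet> v)) + ((p \<bullet> d) * (q \<bullet> d)) * ((c \<bullet> u) * (c \<bullet> v)))
    = X c r s c * ((d \<bullet> u) * (d \<bullet> v)) - X c r s d * ((d \<bullet> u) * (c \<bullet> v)) - X d r s c * ((c \<bullet> u) * (d \<bullet> v)) + X d r s d * ((c \<bullet> u) * (c \<bullet> v))"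
    (is "rcontract X r s (?Q u v) = _") for r s u v
    by (simp only: rcontract_diff rcontract_add rcontract_multc rcontract_vectors[OF X])
  have 12: "(\<lambda>p q. biv c d p q k l) = (\<lambda>p q. ((p \<bullet> c) * (q \<bullet> d) - (p \<bullet> d) * (q \<bullet> c)) * ((c \<bullet> k) * (d \<bullet> l) - (d \<bullet> k) * (c \<bullet> l)))"
    by (intro ext) (simp add: biv_def inner_commute)
  have 34: "(\<lambda>p q. biv c d i j p q) = (\<lambda>p q. ((p \<bullet> c) * (q \<bullet> d) - (p \<bullet> d) * (q \<bullet> c)) * ((c \<bullet> i) * (d \<bullet> j) - (d \<bullet> i) * (c \<bullet> j)))"
    by (intro ext) (simp add: biv_def inner_commute)
  have 13: "(\<lambda>p q. biv c d p j q l) = ?Q j l" by (intro ext) (simp add: biv_def inner_commute algebra_simps)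
  have 14: "rcontract X i l (\<lambda>p q. biv c d p j k q) = - rcontract X i l (?Q j k)"
    by (rule rcontract_uminus) (simp add: biv_def inner_commute algebra_simps)
  have 23: "rcontract X j k (\<lambda>p q. biv c d i p q l) = - rcontract X j k (?Q i l)"
    by (rule rcontract_uminus) (simp add: biv_def inner_commute algebra_simps)
  have 24: "(\<lambda>p q. biv c d i p k q) = ?Q i k" by (intro ext) (simp add: biv_def inner_commute algebra_simps)
  show ?thesis unfolding mult_rcontract[OF X] 12 13 14 23 24 34 1 2 by argo
qed

section \<open>Multiplication table of squared bivectors\<close>

lemma mult_biv_self:
  assumes "a \<bullet> a = 1" "b \<bullet> b = 1" "a \<bullet> b = 0"
  shows "biv a b \<circledast> biv a b = - biv a b"
proof (intro ext)
  fix i j k l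
  have v: "biv a b a i j b = (b \<bullet> i) * (a \<bullet> j)" "biv a b b i j a = (a \<bullet> i) * (b \<bullet> j)"
    "biv a b a i j a = - ((b \<bullet> i) * (b \<bullet> j))" "biv a b b i j b = - ((a \<bullet> i) * (a \<bullet> j))" for i j
    unfolding biv_def by (simp_all add: assms inner_commute[of b a])
  show "(biv a b \<circledast> biv a b) i j k l = (- biv a b) i j k l"
    unfolding mult_biv[OF biv_in_MC] v uminus_apply unfolding biv_def by algebra
qed

text \<open>For planes meeting in the line of \<open>c\<close>, the only surviving value is that of
  the first factor with \<open>c\<close> in both outer slots, which is minus the square of
  \<open>a\<close>. It meets the square of \<open>b\<close> left over from the second factor, and
  together they rebuild \<open>biv a b\<close>.\<close>

lemma mult_biv_adjacent:
  assumes "a \<bullet> a = 1" "b \<bullet> b = 1" "c \<bullet> c = 1" "a \<bullet> b = 0" "a \<bullet> c = 0" "b \<bullet> c = 0"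
  shows "biv a c \<circledast> biv b c = (-1/2) *\<^sub>R biv a b"
proof (intro ext)
  fix i j k l
  have v: "biv a c b i j c = 0" "biv a c c i j b = 0" "biv a c b i j b = 0"
    "biv a c c i j c = - ((a \<bullet> i) * (a \<bullet> j))" for i j
    unfolding biv_def by (simp_all add: assms inner_commute[of b a] inner_commute[of c a] inner_commute[of c b])
  show "(biv a c \<circledast> biv b c) i j k l = ((-1/2) *\<^sub>R biv a b) i j k l"
    unfolding mult_biv[OF biv_in_MC] v scaleR_fun_apply real_scaleR_def unfolding biv_def by algebra
qed

lemma mult_biv_disjoint:
  assumes "a \<bullet> c = 0" "a \<bullet> d = 0" "b \<bullet> c = 0" "b \<bullet> d = 0"
  shows "biv a b \<circledast> biv c d = 0"
proof (intro ext)
  fix i j k l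
  have v: "biv a b c i j x = 0" "biv a b d i j x = 0" for i j x
    unfolding biv_def by (simp_all add: assms)
  show "(biv a b \<circledast> biv c d) i j k l = 0 i j k l"
    unfolding mult_biv[OF biv_in_MC] v by simp
qed

section \<open>Weyl tensors from four orthonormal vectors\<close>

definition sqdiff :: "'a \<Rightarrow> 'a \<Rightarrow> ('a::euclidean_space) \<Rightarrow> 'a \<Rightarrow> real" where
  "sqdiff a b x y = (a \<bullet> x) * (a \<bullet> y) - (b \<bullet> x) * (b \<bullet> y)"

text \<open>This is P - Q in the notation of the opening comment. Permuting the arguments yields the
  other differences of matchings.\<close>

definition weyl4 :: "'a \<Rightarrow> 'a \<Rightarrow> 'a \<Rightarrow> 'a \<Rightarrow> ('a::euclidean_space) form4" where
  "weyl4 a b c d = biv a c + biv b d - biv a d - biv b c"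

definition orthonormal4 :: "'a \<Rightarrow> 'a \<Rightarrow> 'a \<Rightarrow> ('a::euclidean_space) \<Rightarrow> bool" where
  "orthonormal4 a b c d \<longleftrightarrow> a \<bullet> a = 1 \<and> b \<bullet> b = 1 \<and> c \<bullet> c = 1 \<and> d \<bullet> d = 1 \<and>
     a \<bullet> b = 0 \<and> a \<bullet> c = 0 \<and> a \<bullet> d = 0 \<and> b \<bullet> c = 0 \<and> b \<bullet> d = 0 \<and> c \<bullet> d = 0"

lemma sum_Basis_inner_inner: "(\<Sum>p\<in>Basis. (v \<bullet> p) * (w \<bullet> p)) = v \<bullet> (w :: 'a::euclidean_space)"
  by (simp add: euclidean_inner[of v w])

lemma sqdiff_in_sym_forms: "sqdiff a b \<in> sym_forms"
proof -
  have "bilinear (sqdiff a b)"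
    unfolding bilinear_def sqdiff_def
    by (intro conjI allI linear_cmult linear_multc linear_compose_sub linear_inner_right)
  then show ?thesis by (simp add: sym_forms_def sqdiff_def mult.commute)
qed

lemma trace_sqdiff: "trace_form (sqdiff a b) = a \<bullet> a - b \<bullet> b"
  by (simp add: trace_form_def sqdiff_def sum_subtractf sum_Basis_inner_inner)

lemma curlywedge_sqdiff: "curlywedge (sqdiff a b) (sqdiff c d) = (1/2) *\<^sub>R weyl4 a b c d"
proof (intro ext)
  fix i j k l
  show "curlywedge (sqdiff a b) (sqdiff c d) i j k l = ((1/2) *\<^sub>R weyl4 a b c d) i j k l"
    unfolding weyl4_def scaleR_fun_apply real_scaleR_def plus_fun_apply minus_apply curlywedge_def sqdiff_def biv_def
    by algebra
qed

lemma weyl4_in_MC: "weyl4 a b c d \<in> MC"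
  unfolding weyl4_def by (intro subspace_diff subspace_add subspace_MC biv_in_MC)

lemma weyl4_in_MC_W:
  assumes "orthonormal4 a b c d"
  shows "weyl4 a b c d \<in> MC_W"
proof -
  have "ricci (weyl4 a b c d) i j = 0" for i j
    using assms unfolding orthonormal4_def
    by (simp add: weyl4_def ricci_add ricci_diff ricci_biv)
  then show ?thesis by (simp add: MC_W_def weyl4_in_MC fun_eq_iff)
qed

text \<open>This supplies the forms \<open>sqdiff a b\<close> needed to fill \<open>MC_R\<close>.
  Contracting with the square of \<open>c\<close> puts \<open>c\<close> into both outer slots, which
  only the bivectors containing \<open>c\<close> survive; likewise for \<open>d\<close>.\<close>

lemma hat2_weyl4:
  assumes "orthonormal4 a b c d"
  shows "hat2 (weyl4 a b c d) (sqdiff c d) = (-2) *\<^sub>R sqdiff a b"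
proof (intro ext)
  fix r s
  have 1: "hat2 X (sqdiff c d) r s = X c r s c - X d r s d" if "X \<in> MC" for X
    unfolding hat2_def sqdiff_def inner_commute[of c] inner_commute[of d]
    by (simp only: rcontract_diff rcontract_vectors[OF that])
  have v: "biv a c c r s c = - ((a \<bullet> r) * (a \<bullet> s))" "biv b c c r s c = - ((b \<bullet> r) * (b \<bullet> s))"
    "biv a d d r s d = - ((a \<bullet> r) * (a \<bullet> s))" "biv b d d r s d = - ((b \<bullet> r) * (b \<bullet> s))"
    "biv a c d r s d = 0" "biv b c d r s d = 0" "biv a d c r s c = 0" "biv b d c r s c = 0"
    using assms unfolding biv_def orthonormal4_def by (simp_all add: inner_commute[of d c])
  show "hat2 (weyl4 a b c d) (sqdiff c d) r s = ((-2) *\<^sub>R sqdiff a b) r s"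
    unfolding 1[OF weyl4_in_MC] unfolding weyl4_def by (simp add: v sqdiff_def)
qed

text \<open>Of the sixteen products, four have disjoint planes and vanish, and four are squares and
  give - P - Q. The remaining eight share a line and carry a minus sign against the factor -1/2, so
  they add up to 2 R.\<close>

lemma weyl4_square:
  assumes "orthonormal4 a b c d"
  shows "weyl4 a b c d \<circledast> weyl4 a b c d = 2 *\<^sub>R (biv a b + biv c d) - biv a c - biv b d - biv a d - biv b c"
proof -
  have o: "a \<bullet> a = 1" "b \<bullet> b = 1" "c \<bullet> c = 1" "d \<bullet> d = 1"
     "a \<bullet> b = 0" "a \<bullet> c = 0" "a \<bullet> d = 0" "b \<bullet> c = 0" "b \<bullet> d = 0" "c \<bullet> d = 0"
     "b \<bullet> a = 0" "c \<bullet> a = 0" "d \<bullet> a = 0" "c \<bullet> b = 0" "d \<bullet> b = 0" "d \<bullet> c = 0"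
    using assms by (auto simp: orthonormal4_def inner_commute)
  have adj: "biv x z \<circledast> biv y z = (-1/2) *\<^sub>R biv x y" "biv z x \<circledast> biv z y = (-1/2) *\<^sub>R biv x y"
    if "x \<bullet> x = 1" "y \<bullet> y = 1" "z \<bullet> z = 1" "x \<bullet> y = 0" "x \<bullet> z = 0" "y \<bullet> z = 0" for x y z :: 'a
    using mult_biv_adjacent[OF that] biv_commute[of x z] biv_commute[of y z] by simp_all
  have 1: "biv a c \<circledast> biv b d = 0" "biv b d \<circledast> biv a c = 0" "biv a d \<circledast> biv b c = 0" "biv b c \<circledast> biv a d = 0"
    by (simp_all add: mult_biv_disjoint o)
  have 2: "biv a c \<circledast> biv a d = (-1/2) *\<^sub>R biv c d" "biv a d \<circledast> biv a c = (-1/2) *\<^sub>R biv c d"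
    "biv b c \<circledast> biv b d = (-1/2) *\<^sub>R biv c d" "biv b d \<circledast> biv b c = (-1/2) *\<^sub>R biv c d"
    "biv a c \<circledast> biv b c = (-1/2) *\<^sub>R biv a b" "biv b c \<circledast> biv a c = (-1/2) *\<^sub>R biv a b"
    "biv a d \<circledast> biv b d = (-1/2) *\<^sub>R biv a b" "biv b d \<circledast> biv a d = (-1/2) *\<^sub>R biv a b"
    using adj[of c d a] adj[of d c a] adj[of c d b] adj[of d c b] adj[of a b c] adj[of b a c]
      adj[of a b d] adj[of b a d] biv_commute[of c d] biv_commute[of a b] by (simp_all add: o)
  have 3: "biv a c \<circledast> biv a c = - biv a c" "biv a d \<circledast> biv a d = - biv a d" "biv b c \<circledast> biv b c = - biv b c" "biv b d \<circledast> biv b d = - biv b d"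
    by (simp_all add: mult_biv_self o)
  show ?thesis
    unfolding weyl4_def mult_add_left mult_add_right mult_diff_left mult_diff_right 1 2 3
    by (intro ext) simp
qed

text \<open>Here \<open>weyl4 a d c b\<close> is P - R and \<open>weyl4 a c d b\<close> is Q - R.
  Their squares 2 Q - P - R and 2 P - Q - R differ by -3 (P - Q).\<close>

lemma weyl4_as_squares:
  assumes "orthonormal4 a b c d"
  shows "weyl4 a b c d = (-1/3) *\<^sub>R (weyl4 a d c b \<circledast> weyl4 a d c b - weyl4 a c d b \<circledast> weyl4 a c d b)"
proof -
  have "orthonormal4 a d c b" "orthonormal4 a c d b"
    using assms by (auto simp: orthonormal4_def inner_commute)
  note s = this[THEN weyl4_square]
  show ?thesis
    unfolding s unfolding weyl4_def biv_commute[of c b] biv_commute[of d b] biv_commute[of d c]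
    by (intro ext) (simp add: field_simps)
qed

text \<open>The four terms of the expanded square agree by skewness. Orthogonality to
  \<open>weyl4 a b c d\<close> thus becomes a linear relation between the sectional values
  \<open>Y a c a c\<close>, \<open>Y b d b d\<close>, \<open>Y a d a d\<close> and
  \<open>Y b c b c\<close>.\<close>

lemma form_inner_biv:
  assumes Y: "Y \<in> MC"
  shows "form_inner Y (biv a b) = 4 * Y a b a b"
proof -
  note lin = multilinear4_linear[OF MC_multilinear[OF Y]]
  have 1: "(\<Sum>i\<in>Basis. \<Sum>j\<in>Basis. \<Sum>k\<in>Basis. \<Sum>l\<in>Basis. Y i j k l * ((a \<bullet> i) * (b \<bullet> j) * (c \<bullet> k) * (d \<bullet> l))) = Y a b c d"
    for a b c d
  proof -
    have "(\<Sum>i\<in>Basis. \<Sum>j\<in>Basis. \<Sum>k\<in>Basis. \<Sum>l\<in>Basis. Y i j k l * ((a \<bullet> i) * (b \<bullet> j) * (c \<bullet> k) * (d \<bullet> l)))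
      = (\<Sum>i\<in>Basis. (\<Sum>j\<in>Basis. (\<Sum>k\<in>Basis. (\<Sum>l\<in>Basis. Y i j k l * (l \<bullet> d)) * (k \<bullet> c)) * (j \<bullet> b)) * (i \<bullet> a))"
      by (simp add: sum_distrib_left sum_distrib_right inner_commute mult_ac)
    then show ?thesis by (simp add: sum_Basis_inner_linear lin)
  qed
  have "form_inner Y (biv a b) = (\<Sum>i\<in>Basis. \<Sum>j\<in>Basis. \<Sum>k\<in>Basis. \<Sum>l\<in>Basis.
      Y i j k l * ((a \<bullet> i) * (b \<bullet> j) * (a \<bullet> k) * (b \<bullet> l)) - Y i j k l * ((a \<bullet> i) * (b \<bullet> j) * (b \<bullet> k) * (a \<bullet> l))
      - Y i j k l * ((b \<bullet> i) * (a \<bullet> j) * (a \<bullet> k) * (b \<bullet> l)) + Y i j k l * ((b \<bullet> i) * (a \<bullet> j) * (b \<bullet> k) * (a \<bullet> l)))"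
    unfolding form_inner_def biv_def by (intro sum.cong refl) algebra
  also have "\<dots> = Y a b a b - Y a b b a - Y b a a b + Y b a b a"
    by (simp only: sum.distrib sum_subtractf 1)
  also have "\<dots> = 4 * Y a b a b"
    using MC_swap12[OF Y, of b a a b] MC_swap12[OF Y, of b a b a] MC_swap34[OF Y, of a b b a] by simp
  finally show ?thesis .
qed

subsection \<open>A spanning set of the Weyl tensors\<close>

definition rot_plus :: "'a \<Rightarrow> 'a \<Rightarrow> ('a::euclidean_space)" where
  "rot_plus v w = (1 / sqrt 2) *\<^sub>R (v + w)"

definition rot_minus :: "'a \<Rightarrow> 'a \<Rightarrow> ('a::euclidean_space)" where
  "rot_minus v w = (1 / sqrt 2) *\<^sub>R (v - w)"

text \<open>Polarization by a rotation through 45 degrees: a relation between squares of unit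
  vectors passes to off-diagonal components while the vectors stay orthonormal.\<close>

lemma bilinear_rot:
  assumes "bilinear B"
  shows "B (rot_plus v w) (rot_plus v w) - B (rot_minus v w) (rot_minus v w) = (B v w + B w v :: real)"
proof -
  have "1 / sqrt 2 * (1 / sqrt 2 * x) = x / 2" for x :: real
    by (simp add: field_simps flip: power2_eq_square)
  then show ?thesis
    unfolding rot_plus_def rot_minus_def
    by (simp add: bilinear_lmul[OF assms] bilinear_rmul[OF assms] bilinear_ladd[OF assms] bilinear_radd[OF assms]
        bilinear_lsub[OF assms] bilinear_rsub[OF assms] del: times_divide_eq_left) (simp add: field_simps)
qed

lemma orthonormal4_rot:
  assumes "orthonormal4 a b c d"
  shows "orthonormal4 a b (rot_plus c d) (rot_minus c d)"
  using assms unfolding orthonormal4_def rot_plus_def rot_minus_def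
  by (simp add: inner_add_left inner_add_right inner_diff_left inner_diff_right inner_commute[of d c] field_simps
       flip: power2_eq_square)

lemma orthonormal4_swap: "orthonormal4 a b c d \<Longrightarrow> orthonormal4 c d a b"
  by (auto simp: orthonormal4_def inner_commute)

lemma orthonormal4_Basis:
  assumes "u \<in> Basis" "v \<in> Basis" "w \<in> Basis" "z \<in> Basis" "distinct [u, v, w, z]"
  shows "orthonormal4 u v w z"
  using assms by (auto simp: orthonormal4_def inner_Basis)

text \<open>Used on vanishing traces: when all summands but two agree and those two contribute
  nothing in total, the common value is 0.\<close>

lemma sum_except_two:
  fixes f :: "'a \<Rightarrow> real"
  assumes "finite B" "w \<in> B" "z \<in> B" "w \<noteq> z" "\<And>u. u \<in> B \<Longrightarrow> u \<noteq> w \<Longrightarrow> u \<noteq> z \<Longrightarrow> f u = c"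
  shows "sum f B = f w + f z + (real (card B) - 2) * c"
proof -
  have "sum f B = f w + (f z + sum f (B - {w} - {z}))"
    using assms sum.remove[of B w f] sum.remove[of "B - {w}" z f] by simp
  also have "sum f (B - {w} - {z}) = real (card (B - {w} - {z})) * c"
    using assms by simp
  also have "real (card (B - {w} - {z})) = real (card B) - 2"
  proof -
    have "card {w, z} \<le> card B" using assms by (intro card_mono) auto
    then show ?thesis using assms by simp
  qed
  finally show ?thesis by simp
qed

text \<open>A finite set of vectors whose orthonormal quadruples already detect all Weyl tensors, so that
  orthogonal projection is only needed for spans of finite sets.\<close>

definition test_vectors :: "('a::euclidean_space) set" where
  "test_vectors = Basis \<union> (\<lambda>(v, w). rot_plus v w) ` (Basis \<times> Basis) \<union> (\<lambda>(v, w). rot_minus v w) ` (Basis \<times> Basis)"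

lemma finite_test_vectors: "finite test_vectors"
  by (simp add: test_vectors_def)

lemma test_vectorsI:
  "v \<in> Basis \<Longrightarrow> v \<in> test_vectors"
  "v \<in> Basis \<Longrightarrow> w \<in> Basis \<Longrightarrow> rot_plus v w \<in> test_vectors"
  "v \<in> Basis \<Longrightarrow> w \<in> Basis \<Longrightarrow> rot_minus v w \<in> test_vectors"
  unfolding test_vectors_def by auto

text \<open>The components on \<open>Basis\<close> are treated by the number of coinciding indices:
  first those with one repeated vector (\<open>k0\<close>), then the sectional values
  (\<open>keq\<close>, \<open>k1\<close>), and finally four distinct vectors (\<open>alt\<close>,
  \<open>dist\<close>). The skew symmetries reduce every other case to these.\<close>

lemma MC_W_eq_0:
  fixes Y :: "('a::euclidean_space) form4"
  assumes Y: "Y \<in> MC_W" and dim: "DIM('a) > 3"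
    and H: "\<And>a b c d. a \<in> test_vectors \<Longrightarrow> b \<in> test_vectors \<Longrightarrow> c \<in> test_vectors \<Longrightarrow> d \<in> test_vectors \<Longrightarrow>
      orthonormal4 a b c d \<Longrightarrow> Y a c a c + Y b d b d = Y a d a d + Y b c b c"
  shows "Y = 0"
proof -
  have YM: "Y \<in> MC" using Y by (simp add: MC_W_def)
  note lin = multilinear4_linear[OF MC_multilinear[OF YM]]
  note s12 = MC_swap12[OF YM] and s34 = MC_swap34[OF YM]
  have d1: "Y i i k l = 0" and d2: "Y i j k k = 0" for i j k l
    using s12[of i i k l] s34[of i j k k] by simp_all
  have bil: "bilinear (\<lambda>x y. Y a x b y)" "bilinear (\<lambda>x y. Y x a y b)" for a b
    by (auto simp: bilinear_def lin)
  have ric: "(\<Sum>u\<in>Basis. Y u i u j) = 0" for i j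
  proof -
    have "ricci Y i j = 0" using Y by (simp add: MC_W_def)
    then have "(\<Sum>u\<in>Basis. - Y u i u j) = 0" unfolding ricci_def by (simp only: s34[symmetric])
    then show ?thesis by (simp add: sum_negf)
  qed
  have n2: "real DIM('a) - 2 \<noteq> 0" and n1: "real DIM('a) - 1 \<noteq> 0" using dim by linarith+
  \<comment> \<open>Polarization of \<open>H\<close> in its second pair of vectors.\<close>
  have rot: "Y a w a z = Y b w b z"
    if "a \<in> test_vectors" "b \<in> test_vectors" "w \<in> Basis" "z \<in> Basis" "orthonormal4 a b w z" for a b w z
  proof -
    have "Y c (rot_plus w z) c (rot_plus w z) - Y c (rot_minus w z) c (rot_minus w z) = 2 * Y c w c z" for c
      using bilinear_rot[OF bil(1), of c w z c] MC_pair[OF YM, of c z c w] by simp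
    from this[of a] this[of b] show ?thesis
      using H[OF that(1,2) test_vectorsI(2,3)[OF that(3,4)] orthonormal4_rot[OF that(5)]] by linarith
  qed
  \<comment> \<open>By \<open>rot\<close> the value is the same for every basis vector u other than
    w and z, where it vanishes by skewness. The zero trace is therefore n - 2 times this
    value.\<close>
  have k0: "Y u w u z = 0" if "u \<in> Basis" "w \<in> Basis" "z \<in> Basis" "w \<noteq> z" for u w z
  proof (cases "u = w \<or> u = z")
    case False
    have "(\<Sum>v\<in>Basis. Y v w v z) = Y w w w z + Y z w z z + (real (card (Basis :: 'a set)) - 2) * Y u w u z"
    proof (rule sum_except_two)
      fix v :: 'a assume v: "v \<in> Basis" "v \<noteq> w" "v \<noteq> z"
      show "Y v w v z = Y u w u z"
      proof (cases "v = u")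
        case v': False
        then have "orthonormal4 v u w z" using v that False by (intro orthonormal4_Basis) auto
        then show ?thesis using rot v that test_vectorsI(1) by blast
      qed simp
    qed (use that in auto)
    then show ?thesis using ric[of w z] n2 by (simp add: d1 d2)
  qed (auto simp: d1 d2)
  \<comment> \<open>The same trace argument for the difference \<open>f\<close>: it is constant away
    from w and z by \<open>H\<close>, and its values at w and z cancel.\<close>
  have keq: "Y u w u w = Y u z u z"
    if "u \<in> Basis" "w \<in> Basis" "z \<in> Basis" "u \<noteq> w" "u \<noteq> z" for u w z
  proof (cases "w = z")
    case False
    define f where "f u = Y u w u w - Y u z u z" for u
    have "sum f Basis = f w + f z + (real (card (Basis :: 'a set)) - 2) * f u"
    proof (rule sum_except_two)
      fix v :: 'a assume v: "v \<in> Basis" "v \<noteq> w" "v \<noteq> z"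
      show "f v = f u"
      proof (cases "v = u")
        case v': False
        then have "orthonormal4 v u w z" using v that False by (intro orthonormal4_Basis) auto
        then show ?thesis using H[of v u w z] v that test_vectorsI(1) unfolding f_def by fastforce
      qed simp
    qed (use that False in auto)
    moreover have "sum f Basis = 0" by (simp add: f_def sum_subtractf ric)
    moreover have "f w + f z = 0"
      using s12[of w z w z] s34[of z w w z] by (simp add: f_def d1)
    ultimately show ?thesis using n2 by (simp add: f_def)
  qed simp
  \<comment> \<open>All sectional values at u agree by \<open>keq\<close>, so the zero trace at u is
    n - 1 times their common value.\<close>
  have k1: "Y u w u w = 0" if "u \<in> Basis" "w \<in> Basis" for u w
  proof (cases "u = w")
    case False
    have "(\<Sum>z\<in>Basis. Y z u z u) = Y u u u u + Y w u w u + (real (card (Basis :: 'a set)) - 2) * Y w u w u"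
    proof (rule sum_except_two)
      fix v :: 'a assume v: "v \<in> Basis" "v \<noteq> u" "v \<noteq> w"
      then have "Y u v u v = Y u w u w" using keq that False by blast
      then show "Y v u v u = Y w u w u"
        using s12[of v u v u] s34[of u v v u] s12[of w u w u] s34[of u w w u] by simp
    qed (use that False in auto)
    then have "(real DIM('a) - 1) * Y w u w u = 0" using ric[of u u] by (simp add: d1 algebra_simps)
    then have "Y w u w u = 0" using n1 by simp
    then show ?thesis using s12[of w u w u] s34[of u w w u] by simp
  qed (simp add: d1)
  \<comment> \<open>Rotating the first pair as well and polarizing \<open>rot\<close> in the first
    and third slots.\<close>
  have alt: "Y u w v z = - Y v w u z"
    if "u \<in> Basis" "v \<in> Basis" "w \<in> Basis" "z \<in> Basis" "distinct [u, v, w, z]" for u v w z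
  proof -
    have "orthonormal4 (rot_plus u v) (rot_minus u v) w z"
      using that by (intro orthonormal4_swap[OF orthonormal4_rot[OF orthonormal4_swap]] orthonormal4_Basis)
    then have "Y (rot_plus u v) w (rot_plus u v) z = Y (rot_minus u v) w (rot_minus u v) z"
      using that by (intro rot test_vectorsI)
    then show ?thesis using bilinear_rot[OF bil(2), of u v w z] by simp
  qed
  \<comment> \<open>With \<open>alt\<close>, \<open>Y\<close> is alternating in its first three
    slots on distinct basis vectors, so the Bianchi identity reads 3 times the component equals
    0.\<close>
  have dist: "Y u w v z = 0"
    if "u \<in> Basis" "v \<in> Basis" "w \<in> Basis" "z \<in> Basis" "distinct [u, v, w, z]" for u v w z
  proof -
    have "Y u w v z = - Y v w u z" "Y u v w z = - Y w v u z"
      using that by (intro alt; auto)+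
    then show ?thesis
      using MC_bianchi[OF YM, of u w v z] s12[of w v u z] s12[of v u w z] by simp
  qed
  show ?thesis
  proof (rule multilinear4_eq_0[OF MC_multilinear[OF YM]])
    fix i j k l :: 'a assume B: "i \<in> Basis" "j \<in> Basis" "k \<in> Basis" "l \<in> Basis"
    have sec: "Y i j i l = 0" if "i \<in> Basis" "j \<in> Basis" "l \<in> Basis" for i j l
      using k0[of i j l] k1[of i j] that by (cases "j = l") auto
    consider "i = j" | "k = l" | "i = k" | "j = k" | "i = l" | "j = l" | "distinct [i, k, j, l]" by auto
    then show "Y i j k l = 0"
    proof cases
      case 3 then show ?thesis using sec B by blast
    next
      case 4 then show ?thesis using sec[of j i l] s12[of i j k l] B by simp
    next
      case 5 then show ?thesis using sec[of i j k] s34[of i j k l] B by simp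
    next
      case 6 then show ?thesis using sec[of j i k] s12[of i j k l] s34[of j i k l] B by simp
    next
      case 7 then show ?thesis using dist[of i k j l] B by simp
    qed (simp_all add: d1 d2)
  qed
qed

text \<open>A Weyl tensor is projected onto the span of the finitely many generators built from
  \<open>test_vectors\<close>. The remainder is a Weyl tensor orthogonal to them, hence 0 by
  \<open>MC_W_eq_0\<close>.\<close>

lemma MC_W_eq_span_weyl4:
  assumes "DIM('a::euclidean_space) > 3"
  shows "MC_W = span {weyl4 a b c d | a b c d :: 'a. orthonormal4 a b c d}"
proof
  let ?S = "{weyl4 a b c d | a b c d :: 'a. orthonormal4 a b c d}"
  show "span ?S \<subseteq> MC_W"
    by (rule span_minimal[OF _ subspace_MC_W]) (auto simp: weyl4_in_MC_W)
  show "MC_W \<subseteq> span ?S"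
  proof
    fix X :: "'a form4" assume X: "X \<in> MC_W"
    define T where "T = {weyl4 a b c d | a b c d :: 'a. orthonormal4 a b c d \<and>
      a \<in> test_vectors \<and> b \<in> test_vectors \<and> c \<in> test_vectors \<and> d \<in> test_vectors}"
    have "T \<subseteq> (\<lambda>(a, b, c, d). weyl4 a b c d) ` (test_vectors \<times> test_vectors \<times> test_vectors \<times> test_vectors)"
    proof
      fix x assume "x \<in> T"
      then obtain a b c d where "x = weyl4 a b c d" "a \<in> test_vectors" "b \<in> test_vectors"
        "c \<in> test_vectors" "d \<in> test_vectors" unfolding T_def by blast
      then show "x \<in> (\<lambda>(a, b, c, d). weyl4 a b c d) ` (test_vectors \<times> test_vectors \<times> test_vectors \<times> test_vectors)"
        by (intro image_eqI[of _ _ "(a, b, c, d)"]) simp_all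
    qed
    then have "finite T" by (rule finite_subset) (simp add: finite_test_vectors)
    moreover have "T \<subseteq> MC" using weyl4_in_MC by (auto simp: T_def)
    moreover have "X \<in> MC" using X by (simp add: MC_W_def)
    ultimately obtain W where W: "W \<in> span T" and W': "\<forall>s\<in>T. form_inner (X - W) s = 0"
      using orthogonal_projection_span[of T X] by blast
    have "T \<subseteq> ?S" unfolding T_def by blast
    then have WS: "W \<in> span ?S" using W span_mono[of T ?S] by blast
    then have XW: "X - W \<in> MC_W"
      using \<open>span ?S \<subseteq> MC_W\<close> by (intro subspace_diff[OF subspace_MC_W X]) blast
    then have M: "X - W \<in> MC" by (simp add: MC_W_def)
    have "X - W = 0"
    proof (rule MC_W_eq_0[OF XW assms])
      fix a b c d :: 'a
      assume "a \<in> test_vectors" "b \<in> test_vectors" "c \<in> test_vectors" "d \<in> test_vectors" "orthonormal4 a b c d"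
      then have "form_inner (X - W) (weyl4 a b c d) = 0" using W' unfolding T_def by blast
      then show "(X - W) a c a c + (X - W) b d b d = (X - W) a d a d + (X - W) b c b c"
        unfolding weyl4_def form_inner_add_right form_inner_diff_right form_inner_biv[OF M] by argo
    qed
    then show "X \<in> span ?S" using WS unfolding right_minus_eq by simp
  qed
qed

subsection \<open>The trace-free part\<close>

lemma curlywedge_add_right: "curlywedge \<alpha> (\<beta> + \<gamma>) = curlywedge \<alpha> \<beta> + curlywedge \<alpha> \<gamma>"
  and curlywedge_scaleR_right: "curlywedge \<alpha> (c *\<^sub>R \<beta>) = c *\<^sub>R curlywedge \<alpha> \<beta>"
  and curlywedge_scaleR_left: "curlywedge (c *\<^sub>R \<alpha>) \<beta> = c *\<^sub>R curlywedge \<alpha> \<beta>"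
  by (intro ext, simp add: curlywedge_def field_simps)+

lemma curlywedge_commute:
  assumes "\<alpha> \<in> sym_forms" "\<beta> \<in> sym_forms"
  shows "curlywedge \<alpha> \<beta> = curlywedge \<beta> \<alpha>"
proof (intro ext)
  fix i j k l
  show "curlywedge \<alpha> \<beta> i j k l = curlywedge \<beta> \<alpha> i j k l"
    unfolding curlywedge_def
      sym_formsD(2)[OF assms(1), of k i] sym_formsD(2)[OF assms(1), of k j] sym_formsD(2)[OF assms(1), of l i] sym_formsD(2)[OF assms(1), of l j]
      sym_formsD(2)[OF assms(2), of k i] sym_formsD(2)[OF assms(2), of k j] sym_formsD(2)[OF assms(2), of l i] sym_formsD(2)[OF assms(2), of l j]
    by algebra
qed

lemma subspace_sym_forms: "subspace sym_forms"
  by (rule subspaceI)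
    (auto simp: sym_forms_def bilinear_def plus_fun_def zero_fun_def scaleR_fun_def linear_zero linear_compose_add linear_cmult)

lemma trace_form_add: "trace_form (\<alpha> + \<beta>) = trace_form \<alpha> + trace_form \<beta>"
  and trace_form_scaleR: "trace_form (c *\<^sub>R \<alpha>) = c * trace_form \<alpha>"
  by (simp_all add: trace_form_def sum.distrib sum_distrib_left)

lemma trace_form_inner: "trace_form (inner :: 'a \<Rightarrow> 'a \<Rightarrow> real) = real DIM('a::euclidean_space)"
  by (simp add: trace_form_def inner_same_Basis)

lemma hat2_in_sym_forms:
  assumes "X \<in> MC" "\<alpha> \<in> sym_forms"
  shows "hat2 X \<alpha> \<in> sym_forms"
proof -
  have "hat2 X \<alpha> s r = hat2 X \<alpha> r s" for r s
    unfolding hat2_def by (rule rcontract_swap[OF assms(1) sym_formsD(2)[OF assms(2)]])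
  moreover have "bilinear (hat2 X \<alpha>)"
    unfolding bilinear_def hat2_def by (intro conjI allI linear_rcontract assms)
  ultimately show ?thesis unfolding sym_forms_def by blast
qed

lemma ricci_in_sym_forms: "X \<in> MC \<Longrightarrow> ricci X \<in> sym_forms"
  using hat2_in_sym_forms[OF _ inner_in_sym_forms] by (simp add: hat2_inner)

lemma ricci_MC_W: "X \<in> MC_W \<Longrightarrow> ricci X = 0"
  by (simp add: MC_W_def)

lemma trace_hat2_W:
  assumes "X \<in> MC_W"
  shows "trace_form (hat2 X \<alpha>) = 0"
proof -
  have X: "X \<in> MC" using assms by (simp add: MC_W_def)
  have 1: "(\<Sum>i\<in>Basis. X p i i q) = 0" for p q
  proof -
    have "X p i i q = X i q p i" for i by (rule MC_pair[OF X])
    then show ?thesis using ricci_MC_W[OF assms] by (simp add: ricci_def fun_eq_iff)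
  qed
  have "trace_form (hat2 X \<alpha>) = (\<Sum>p\<in>Basis. \<Sum>i\<in>Basis. \<Sum>q\<in>Basis. X p i i q * \<alpha> p q)"
    unfolding trace_form_def hat2_def rcontract_def contract_def by (rule sum.swap)
  also have "\<dots> = (\<Sum>p\<in>Basis. \<Sum>q\<in>Basis. \<Sum>i\<in>Basis. X p i i q * \<alpha> p q)"
    by (rule sum.cong[OF refl], rule sum.swap)
  also have "\<dots> = 0" by (simp add: 1 flip: sum_distrib_right)
  finally show ?thesis .
qed

lemma mult_curlywedge:
  assumes "X \<in> MC" "\<alpha> \<in> sym_forms"
  shows "X \<circledast> curlywedge inner \<alpha> = (1/2) *\<^sub>R (curlywedge (ricci X) \<alpha> + curlywedge inner (hat2 X \<alpha>))"
  by (intro ext) (simp add: mult_wedge[OF assms])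

lemma mult_curlywedge_inner:
  assumes "X \<in> MC"
  shows "X \<circledast> curlywedge inner inner = curlywedge inner (ricci X)"
  unfolding mult_curlywedge[OF assms inner_in_sym_forms] hat2_inner
    curlywedge_commute[OF ricci_in_sym_forms[OF assms] inner_in_sym_forms]
  by (intro ext) simp

lemma ricci_curlywedge_trace_free:
  assumes "(\<alpha> :: 'a::euclidean_space \<Rightarrow> 'a \<Rightarrow> real) \<in> sym_forms" "trace_form \<alpha> = 0"
  shows "ricci (curlywedge inner \<alpha>) = ((2 - real DIM('a)) / 2) *\<^sub>R \<alpha>"
  by (intro ext) (simp add: ricci_wedge[OF assms(1)] assms(2))

text \<open>Each of the four terms of h \<and> \<alpha> contracts one slot of the first pair of
  \<open>Z\<close> with one slot of the second. All such traces equal the Ricci trace up to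
  sign.\<close>

lemma form_inner_curlywedge_W:
  assumes Z: "Z \<in> MC_W"
  shows "form_inner (curlywedge inner \<alpha>) Z = 0"
proof -
  have M: "Z \<in> MC" using Z by (simp add: MC_W_def)
  have r0: "(\<Sum>p\<in>Basis. Z p i j p) = 0" for i j
    using ricci_MC_W[OF Z] by (simp add: ricci_def fun_eq_iff)
  have r1: "(\<Sum>p\<in>Basis. Z p i p j) = 0" for i j
    using r0[of i j] by (subst MC_swap34[OF M]) (simp add: sum_negf)
  have r2: "(\<Sum>p\<in>Basis. Z i p j p) = 0" for i j
    using r1[of i j] by (subst MC_swap12[OF M], subst MC_swap34[OF M]) simp
  have r3: "(\<Sum>p\<in>Basis. Z i p p j) = 0" for i j
    using r1[of i j] by (subst MC_swap12[OF M]) (simp add: sum_negf)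
  have c: "(\<Sum>q\<in>Basis. (q \<bullet> p) * f q) = f p" if "p \<in> Basis" for p and f :: "'a \<Rightarrow> real"
  proof -
    have "(\<Sum>q\<in>Basis. (q \<bullet> p) * f q) = (\<Sum>q\<in>Basis. if q = p then f q else 0)"
      using that by (intro sum.cong) (auto simp: inner_Basis)
    then show ?thesis using that by simp
  qed
  have sw: "(\<Sum>i\<in>Basis. \<Sum>j\<in>Basis. \<Sum>k\<in>Basis. \<Sum>l\<in>Basis. F i j k l :: real)
      = (\<Sum>i\<in>Basis. \<Sum>j\<in>Basis. \<Sum>l\<in>Basis. \<Sum>k\<in>Basis. F i j k l)" for F :: "'a \<Rightarrow> 'a \<Rightarrow> 'a \<Rightarrow> 'a \<Rightarrow> real"
    by (rule sum.cong[OF refl], rule sum.cong[OF refl], rule sum.swap)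
  have t1: "(\<Sum>i\<in>Basis. \<Sum>j\<in>Basis. \<Sum>k\<in>Basis. \<Sum>l\<in>Basis. (k \<bullet> i) * (\<alpha> j l * Z i j k l)) = 0"
  proof -
    have "(\<Sum>i\<in>Basis. \<Sum>j\<in>Basis. \<Sum>k\<in>Basis. \<Sum>l\<in>Basis. (k \<bullet> i) * (\<alpha> j l * Z i j k l)) =
       (\<Sum>i\<in>Basis. \<Sum>j\<in>Basis. \<Sum>l\<in>Basis. \<alpha> j l * Z i j i l)"
      by (subst sw) (intro sum.cong refl, simp add: c)
    also have "\<dots> = (\<Sum>j\<in>Basis. \<Sum>i\<in>Basis. \<Sum>l\<in>Basis. \<alpha> j l * Z i j i l)" by (rule sum.swap)
    also have "\<dots> = (\<Sum>j\<in>Basis. \<Sum>l\<in>Basis. \<Sum>i\<in>Basis. \<alpha> j l * Z i j i l)"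
      by (rule sum.cong[OF refl], rule sum.swap)
    also have "\<dots> = 0" by (simp add: r1 flip: sum_distrib_left)
    finally show ?thesis .
  qed
  have t2: "(\<Sum>i\<in>Basis. \<Sum>j\<in>Basis. \<Sum>k\<in>Basis. \<Sum>l\<in>Basis. (k \<bullet> j) * (\<alpha> i l * Z i j k l)) = 0"
  proof -
    have "(\<Sum>i\<in>Basis. \<Sum>j\<in>Basis. \<Sum>k\<in>Basis. \<Sum>l\<in>Basis. (k \<bullet> j) * (\<alpha> i l * Z i j k l)) =
       (\<Sum>i\<in>Basis. \<Sum>j\<in>Basis. \<Sum>l\<in>Basis. \<alpha> i l * Z i j j l)"
      by (subst sw) (intro sum.cong refl, simp add: c)
    also have "\<dots> = (\<Sum>i\<in>Basis. \<Sum>l\<in>Basis. \<Sum>j\<in>Basis. \<alpha> i l * Z i j j l)"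
      by (rule sum.cong[OF refl], rule sum.swap)
    also have "\<dots> = 0" by (simp add: r3 flip: sum_distrib_left)
    finally show ?thesis .
  qed
  have t3: "(\<Sum>i\<in>Basis. \<Sum>j\<in>Basis. \<Sum>k\<in>Basis. \<Sum>l\<in>Basis. (l \<bullet> i) * (\<alpha> j k * Z i j k l)) = 0"
  proof -
    have "(\<Sum>i\<in>Basis. \<Sum>j\<in>Basis. \<Sum>k\<in>Basis. \<Sum>l\<in>Basis. (l \<bullet> i) * (\<alpha> j k * Z i j k l)) =
       (\<Sum>i\<in>Basis. \<Sum>j\<in>Basis. \<Sum>k\<in>Basis. \<alpha> j k * Z i j k i)"
      by (intro sum.cong refl) (simp add: c)
    also have "\<dots> = (\<Sum>j\<in>Basis. \<Sum>i\<in>Basis. \<Sum>l\<in>Basis. \<alpha> j l * Z i j l i)" by (rule sum.swap)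
    also have "\<dots> = (\<Sum>j\<in>Basis. \<Sum>l\<in>Basis. \<Sum>i\<in>Basis. \<alpha> j l * Z i j l i)"
      by (rule sum.cong[OF refl], rule sum.swap)
    also have "\<dots> = 0" by (simp add: r0 flip: sum_distrib_left)
    finally show ?thesis .
  qed
  have t4: "(\<Sum>i\<in>Basis. \<Sum>j\<in>Basis. \<Sum>k\<in>Basis. \<Sum>l\<in>Basis. (l \<bullet> j) * (\<alpha> i k * Z i j k l)) = 0"
  proof -
    have "(\<Sum>i\<in>Basis. \<Sum>j\<in>Basis. \<Sum>k\<in>Basis. \<Sum>l\<in>Basis. (l \<bullet> j) * (\<alpha> i k * Z i j k l)) =
       (\<Sum>i\<in>Basis. \<Sum>j\<in>Basis. \<Sum>k\<in>Basis. \<alpha> i k * Z i j k j)"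
      by (intro sum.cong refl) (simp add: c)
    also have "\<dots> = (\<Sum>i\<in>Basis. \<Sum>l\<in>Basis. \<Sum>j\<in>Basis. \<alpha> i l * Z i j l j)"
      by (rule sum.cong[OF refl], rule sum.swap)
    also have "\<dots> = 0" by (simp add: r2 flip: sum_distrib_left)
    finally show ?thesis .
  qed
  have "2 * form_inner (curlywedge inner \<alpha>) Z = (\<Sum>i\<in>Basis. \<Sum>j\<in>Basis. \<Sum>k\<in>Basis. \<Sum>l\<in>Basis.
      (k \<bullet> i) * (\<alpha> j l * Z i j k l) - (k \<bullet> j) * (\<alpha> i l * Z i j k l)
      - (l \<bullet> i) * (\<alpha> j k * Z i j k l) + (l \<bullet> j) * (\<alpha> i k * Z i j k l))"
    unfolding form_inner_def sum_distrib_left curlywedge_def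
    by (intro sum.cong refl) algebra
  also have "\<dots> = 0" by (simp only: sum.distrib sum_subtractf t1 t2 t3 t4)
  finally show ?thesis by simp
qed

text \<open>This evaluates the definite description in \<open>tf\<close>. Two candidates differ by a
  Weyl tensor that is orthogonal to itself.\<close>

lemma tf_eq:
  assumes W: "W \<in> MC_W"
  shows "tf (W + curlywedge inner \<alpha>) = W"
  unfolding tf_def
proof (rule the_equality)
  show "W \<in> MC_W \<and> (\<forall>Z\<in>MC_W. form_inner (W + curlywedge inner \<alpha> - W) Z = 0)"
    using W by (simp add: form_inner_curlywedge_W)
  fix V assume V: "V \<in> MC_W \<and> (\<forall>Z\<in>MC_W. form_inner (W + curlywedge inner \<alpha> - V) Z = 0)"
  have D: "W - V \<in> MC_W" using V W subspace_diff[OF subspace_MC_W] by blast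
  then have "form_inner (W + curlywedge inner \<alpha> - V) (W - V) = 0" using V by blast
  then have "form_inner (W - V) (W - V) = 0"
    using form_inner_curlywedge_W[OF D, of \<alpha>] unfolding form_inner_add_left form_inner_diff_left by linarith
  then have "W - V = 0" using D by (intro form_inner_eq_0) (simp_all add: MC_W_def)
  then show "V = W" unfolding right_minus_eq by simp
qed

text \<open>The Ricci decomposition; \<alpha> is a multiple of the Schouten tensor of
  \<open>X\<close>.\<close>

lemma MC_decomposition:
  assumes "(X :: ('a::euclidean_space) form4) \<in> MC" "DIM('a) > 2"
  obtains W \<alpha> where "W \<in> MC_W" "\<alpha> \<in> sym_forms" "X = W + curlywedge inner \<alpha>"
proof
  define n where "n = real DIM('a)"
  have n: "2 - n \<noteq> 0" "1 - n \<noteq> 0" using assms(2) by (auto simp: n_def)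
  \<comment> \<open>The equation to solve is ((2 - n) \<alpha> - tr \<alpha> h)/2 =
    \<open>ricci X\<close>. Taking its trace gives (1 - n) tr \<alpha> = tr \<open>ricci X\<close>,
    so \<open>t\<close> is half of tr \<alpha>.\<close>
  define t where "t = trace_form (ricci X) / (2 - 2 * n)"
  define \<alpha> where "\<alpha> = (2 / (2 - n)) *\<^sub>R (ricci X + t *\<^sub>R inner)"
  show \<alpha>: "\<alpha> \<in> sym_forms"
    unfolding \<alpha>_def by (intro subspace_scale subspace_add subspace_sym_forms ricci_in_sym_forms inner_in_sym_forms assms)
  have "trace_form (ricci X) = (2 - 2 * n) * t" using n by (simp add: t_def field_simps)
  then have "trace_form \<alpha> = 2 / (2 - n) * ((2 - 2 * n) * t + t * n)"
    by (simp add: \<alpha>_def trace_form_add trace_form_scaleR trace_form_inner n_def)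
  also have "(2 - 2 * n) * t + t * n = (2 - n) * t" by algebra
  finally have tr: "trace_form \<alpha> = 2 * t" using n by simp
  have "ricci (curlywedge inner \<alpha>) i j = ricci X i j" for i j
  proof -
    have "(2 - n) * \<alpha> i j = 2 * (ricci X i j + t * (i \<bullet> j))" using n by (simp add: \<alpha>_def)
    then show ?thesis unfolding ricci_wedge[OF \<alpha>] tr n_def[symmetric] by simp
  qed
  then have "ricci (X - curlywedge inner \<alpha>) = 0" by (simp add: ricci_diff fun_eq_iff)
  then show "X - curlywedge inner \<alpha> \<in> MC_W"
    using subspace_diff[OF subspace_MC assms(1) curlywedge_in_MC[OF inner_in_sym_forms \<alpha>]] by (simp add: MC_W_def)
qed simp

text \<open>As a definite description, \<open>tf\<close> is not linear by construction; on
  \<open>MC\<close> its linearity is read off the decomposition. It is needed so that the image in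
  (v) contains the span of any generators found in it.\<close>

lemma subspace_tf_image:
  assumes "subspace U" "U \<subseteq> (MC :: ('a::euclidean_space) form4 set)" "DIM('a) > 2"
  shows "subspace (tf ` U)"
proof (rule subspaceI)
  have "0 + curlywedge inner 0 = (0 :: 'a form4)" by (intro ext) (simp add: curlywedge_def)
  then have "tf (0 :: 'a form4) = 0" using tf_eq[of "0 :: 'a form4" 0] subspace_0[OF subspace_MC_W] by simp
  then show "0 \<in> tf ` U" using subspace_0[OF assms(1)] by force
next
  fix x y assume "x \<in> tf ` U" "y \<in> tf ` U"
  then obtain X Y where XY: "X \<in> U" "Y \<in> U" "x = tf X" "y = tf Y" by blast
  then have "X \<in> MC" "Y \<in> MC" using assms(2) by blast+
  then obtain V W \<alpha> \<beta> where VW: "V \<in> MC_W" "W \<in> MC_W" "X = V + curlywedge inner \<alpha>" "Y = W + curlywedge inner \<beta>"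
    using MC_decomposition[OF _ assms(3)] by metis
  have "X + Y = (V + W) + curlywedge inner (\<alpha> + \<beta>)" unfolding VW curlywedge_add_right by (simp add: algebra_simps)
  then have "tf (X + Y) = V + W" using tf_eq subspace_add[OF subspace_MC_W VW(1,2)] by metis
  moreover have "x = V" "y = W" unfolding XY VW by (intro tf_eq VW)+
  ultimately show "x + y \<in> tf ` U" using subspace_add[OF assms(1) XY(1,2)] by (metis imageI)
next
  fix x and c :: real assume "x \<in> tf ` U"
  then obtain X where X: "X \<in> U" "x = tf X" by blast
  then have "X \<in> MC" using assms(2) by blast
  then obtain V \<alpha> where V: "V \<in> MC_W" "X = V + curlywedge inner \<alpha>"
    using MC_decomposition[OF _ assms(3)] by metis
  have "c *\<^sub>R X = c *\<^sub>R V + curlywedge inner (c *\<^sub>R \<alpha>)" unfolding V curlywedge_scaleR_right by (rule scaleR_add_right)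
  then have "tf (c *\<^sub>R X) = c *\<^sub>R V" using tf_eq subspace_scale[OF subspace_MC_W V(1)] by metis
  moreover have "x = V" unfolding X V by (intro tf_eq V)
  ultimately show "c *\<^sub>R x \<in> tf ` U" using subspace_scale[OF assms(1) X(1)] by (metis imageI)
qed

subsection \<open>Products of the irreducible submodules\<close>

lemma subspace_mult_span: "subspace (U \<circledast>\<^sub>s V)"
  unfolding mc_mult_span_def by (rule subspace_span)

lemma mult_in_mult_span: "X \<in> U \<Longrightarrow> Y \<in> V \<Longrightarrow> X \<circledast> Y \<in> U \<circledast>\<^sub>s V"
  unfolding mc_mult_span_def by (rule span_base) blast

lemma mult_span_subset:
  assumes "\<And>X Y. X \<in> U \<Longrightarrow> Y \<in> V \<Longrightarrow> X \<circledast> Y \<in> S" "subspace S"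
  shows "U \<circledast>\<^sub>s V \<subseteq> S"
  unfolding mc_mult_span_def using assms by (intro span_minimal) auto

lemma MC_R_I: "\<alpha> \<in> sym_forms \<Longrightarrow> trace_form \<alpha> = 0 \<Longrightarrow> curlywedge inner \<alpha> \<in> MC_R"
  unfolding MC_R_def by blast

lemma MC_R_E:
  assumes "X \<in> MC_R"
  obtains \<alpha> where "\<alpha> \<in> sym_forms" "trace_form \<alpha> = 0" "X = curlywedge inner \<alpha>"
  using assms unfolding MC_R_def by blast

lemma MC_S_I: "curlywedge inner inner \<in> MC_S"
  unfolding MC_S_def by (rule span_base) simp

lemma MC_S_E:
  assumes "X \<in> MC_S"
  obtains c where "X = c *\<^sub>R curlywedge inner inner"
  using assms unfolding MC_S_def span_singleton by blast

lemma MC_R_subset_MC: "MC_R \<subseteq> MC"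
  using curlywedge_in_MC[OF inner_in_sym_forms] by (auto elim!: MC_R_E)

lemma subspace_MC_R: "subspace MC_R"
proof (rule subspaceI)
  have "curlywedge inner 0 = (0 :: 'a form4)" by (intro ext) (simp add: curlywedge_def)
  then show "0 \<in> (MC_R :: 'a form4 set)"
    using MC_R_I[of "0 :: 'a \<Rightarrow> 'a \<Rightarrow> real"] subspace_0[OF subspace_sym_forms] by (simp add: trace_form_def)
next
  fix X Y :: "'a form4" assume "X \<in> MC_R" "Y \<in> MC_R"
  then obtain \<alpha> \<beta> where "\<alpha> \<in> sym_forms" "trace_form \<alpha> = 0" "X = curlywedge inner \<alpha>"
    "\<beta> \<in> sym_forms" "trace_form \<beta> = 0" "Y = curlywedge inner \<beta>" by (metis MC_R_E)
  then show "X + Y \<in> MC_R"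
    using MC_R_I[of "\<alpha> + \<beta>"] subspace_add[OF subspace_sym_forms, of \<alpha> \<beta>] by (simp add: trace_form_add flip: curlywedge_add_right)
next
  fix X :: "'a form4" and c assume "X \<in> MC_R"
  then obtain \<alpha> where "\<alpha> \<in> sym_forms" "trace_form \<alpha> = 0" "X = curlywedge inner \<alpha>" by (metis MC_R_E)
  then show "c *\<^sub>R X \<in> MC_R"
    using MC_R_I[of "c *\<^sub>R \<alpha>"] subspace_scale[OF subspace_sym_forms, of \<alpha> c] by (simp add: trace_form_scaleR flip: curlywedge_scaleR_right)
qed

section \<open>Generators of the trace-free symmetric forms\<close>

lemma obtain_Basis_complement:
  fixes i j :: "'a::euclidean_space"
  assumes "i \<in> Basis" "j \<in> Basis" "i \<noteq> j" "DIM('a) > 3"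
  obtains c d :: 'a where "orthonormal4 i j c d"
proof -
  have "card (Basis - {i, j} :: 'a set) \<ge> 2"
    using assms by simp
  then obtain c d where "c \<in> Basis - {i, j}" "d \<in> Basis - {i, j}" "c \<noteq> d"
    by (metis One_nat_def Suc_1 card_le_Suc0_iff_eq finite_Basis finite_Diff not_less_eq_eq)
  then have "orthonormal4 i j c d" using assms by (intro orthonormal4_Basis) auto
  then show ?thesis using that by blast
qed

lemma sqdiff_rot:
  "sqdiff (rot_plus v w) (rot_minus v w) x y = (v \<bullet> x) * (w \<bullet> y) + (w \<bullet> x) * (v \<bullet> y)"
proof -
  have "bilinear (\<lambda>v w :: 'a. (v \<bullet> x) * (w \<bullet> y))"
    by (simp add: bilinear_def linear_iff algebra_simps inner_add_left)
  from bilinear_rot[OF this] show ?thesis by (simp add: sqdiff_def)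
qed

text \<open>Differences of squares of orthonormal vectors span these forms. The hypothesis
  \<open>sq\<close> covers only pairs with two further orthonormal vectors \<open>c\<close>,
  \<open>d\<close>, as \<open>hat2_weyl4\<close> requires; dimension above 3 always provides
  them.\<close>

lemma trace_free_form_induct:
  fixes \<alpha> :: "'a::euclidean_space \<Rightarrow> 'a \<Rightarrow> real"
  assumes \<alpha>: "\<alpha> \<in> sym_forms" "trace_form \<alpha> = 0" and dim: "DIM('a) > 3" and S: "subspace S"
    and sq: "\<And>a b c d. orthonormal4 a b c d \<Longrightarrow> sqdiff a b \<in> S"
  shows "\<alpha> \<in> S"
proof -
  obtain e :: 'a where e: "e \<in> Basis" using nonempty_Basis by blast
  \<comment> \<open>\<open>P i j\<close> is the symmetric product of i and j, with twice the square
    of \<open>e\<close> subtracted on the diagonal to remove the trace. In the sum weighted by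
    \<alpha> these corrections add up to a multiple of tr \<alpha> = 0, which leaves 2
    \<alpha>.\<close>
  define P where "P i j = (if i = j then 2 *\<^sub>R sqdiff i e else sqdiff (rot_plus i j) (rot_minus i j))" for i j :: 'a
  have P: "P i j \<in> S" if ij: "i \<in> Basis" "j \<in> Basis" for i j
  proof (cases "i = j")
    case True
    show ?thesis
    proof (cases "i = e")
      case True
      then have "P i j = 0" using \<open>i = j\<close> by (simp add: P_def sqdiff_def fun_eq_iff)
      then show ?thesis using subspace_0[OF S] by simp
    next
      case False
      then obtain c d where "orthonormal4 i e c d" using obtain_Basis_complement[OF ij(1) e _ dim] by blast
      then show ?thesis using sq subspace_scale[OF S] True by (simp add: P_def)
    qed
  next
    case False
    then obtain c d where "orthonormal4 i j c d" using obtain_Basis_complement[OF ij _ dim] by blast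
    then show ?thesis using sq[OF orthonormal4_swap[OF orthonormal4_rot[OF orthonormal4_swap]]] False by (simp add: P_def)
  qed
  have "\<alpha> x y = ((1/2) *\<^sub>R (\<Sum>i\<in>Basis. \<Sum>j\<in>Basis. \<alpha> i j *\<^sub>R P i j)) x y" for x y
  proof -
    have sum_app: "(\<Sum>i\<in>B. F i) x y = (\<Sum>i\<in>B. F i x y)" for B and F :: "'a \<Rightarrow> 'a \<Rightarrow> 'a \<Rightarrow> real"
      by (induction B rule: infinite_finite_induct) simp_all
    have P': "P i j x y = (i \<bullet> x) * (j \<bullet> y) + (j \<bullet> x) * (i \<bullet> y) - (if i = j then 2 * ((e \<bullet> x) * (e \<bullet> y)) else 0)" for i j
      by (simp add: P_def sqdiff_rot) (simp add: sqdiff_def)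
    have lin: "linear (\<lambda>x. \<alpha> x y)" "linear (\<alpha> x)" for x y
      using sym_formsD(1)[OF \<alpha>(1)] unfolding bilinear_def by blast+
    have 1: "(\<Sum>i\<in>Basis. \<Sum>j\<in>Basis. \<alpha> i j * ((i \<bullet> v) * (j \<bullet> w))) = \<alpha> v w" for v w
    proof -
      have "(\<Sum>i\<in>Basis. \<Sum>j\<in>Basis. \<alpha> i j * ((i \<bullet> v) * (j \<bullet> w))) = (\<Sum>i\<in>Basis. (\<Sum>j\<in>Basis. \<alpha> i j * (j \<bullet> w)) * (i \<bullet> v))"
        by (simp add: sum_distrib_left sum_distrib_right mult_ac)
      then show ?thesis by (simp add: sum_Basis_inner_linear lin)
    qed
    have 2: "(\<Sum>i\<in>Basis. \<Sum>j\<in>Basis. \<alpha> i j * (if i = j then t else 0)) = 0" for t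
    proof -
      have "(\<Sum>i\<in>Basis. \<Sum>j\<in>Basis. \<alpha> i j * (if i = j then t else 0)) = (\<Sum>i\<in>Basis. \<alpha> i i * t)"
        by (simp add: if_distrib[of "\<lambda>x. _ * x"] cong: if_cong)
      then show ?thesis using \<alpha>(2) by (simp add: trace_form_def flip: sum_distrib_right)
    qed
    have "(\<Sum>i\<in>Basis. \<Sum>j\<in>Basis. \<alpha> i j * P i j x y) = (\<Sum>i\<in>Basis. \<Sum>j\<in>Basis. \<alpha> i j * ((i \<bullet> x) * (j \<bullet> y))
       + \<alpha> i j * ((i \<bullet> y) * (j \<bullet> x)) - \<alpha> i j * (if i = j then 2 * ((e \<bullet> x) * (e \<bullet> y)) else 0))"
      unfolding P' by (intro sum.cong refl) (simp only: algebra_simps)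
    also have "\<dots> = \<alpha> x y + \<alpha> y x" by (simp only: sum.distrib sum_subtractf 1 2 diff_zero)
    finally show ?thesis using sym_formsD(2)[OF \<alpha>(1), of y x] by (simp add: sum_app)
  qed
  then have "\<alpha> = (1/2) *\<^sub>R (\<Sum>i\<in>Basis. \<Sum>j\<in>Basis. \<alpha> i j *\<^sub>R P i j)" by blast
  also have "\<dots> \<in> S" by (intro subspace_scale subspace_sum S P)
  finally show ?thesis .
qed

section \<open>The six product identities\<close>

lemma MC_S_mult_MC_S:
  assumes "DIM('a::euclidean_space) > 1"
  shows "(MC_S :: 'a form4 set) \<circledast>\<^sub>s MC_S = MC_S"
proof
  let ?h = "curlywedge inner inner :: 'a form4"
  have S: "subspace (MC_S :: 'a form4 set)" unfolding MC_S_def by (rule subspace_span)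
  have "ricci ?h = (1 - real DIM('a)) *\<^sub>R inner"
    by (intro ext) (simp add: ricci_wedge[OF inner_in_sym_forms] trace_form_inner field_simps)
  moreover have "?h \<circledast> ?h = curlywedge inner (ricci ?h)"
    by (intro mult_curlywedge_inner curlywedge_in_MC inner_in_sym_forms)
  ultimately have h: "?h \<circledast> ?h = (1 - real DIM('a)) *\<^sub>R ?h"
    by (simp only: curlywedge_scaleR_right)
  show "(MC_S :: 'a form4 set) \<circledast>\<^sub>s MC_S \<subseteq> MC_S"
  proof (rule mult_span_subset[OF _ S])
    fix X Y :: "'a form4" assume "X \<in> MC_S" "Y \<in> MC_S"
    then obtain c d where XY: "X = c *\<^sub>R ?h" "Y = d *\<^sub>R ?h" by (metis MC_S_E)
    show "X \<circledast> Y \<in> MC_S"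
      unfolding XY mult_scaleR_left mult_scaleR_right h by (intro subspace_scale[OF S] MC_S_I)
  qed
  have "?h = (1 / (1 - real DIM('a))) *\<^sub>R (?h \<circledast> ?h)" using assms unfolding h by simp
  also have "\<dots> \<in> MC_S \<circledast>\<^sub>s MC_S" by (intro subspace_scale[OF subspace_mult_span] mult_in_mult_span MC_S_I)
  finally show "MC_S \<subseteq> (MC_S :: 'a form4 set) \<circledast>\<^sub>s MC_S"
    unfolding MC_S_def[of] by (intro span_minimal) (simp_all add: subspace_mult_span MC_S_def)
qed

lemma MC_R_mult_MC_S:
  assumes "DIM('a::euclidean_space) > 2"
  shows "(MC_R :: 'a form4 set) \<circledast>\<^sub>s MC_S = MC_R"
proof
  let ?h = "curlywedge inner inner :: 'a form4"
  define t where "t = (2 - real DIM('a)) / 2"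
  have t: "t \<noteq> 0" using assms by (simp add: t_def)
  \<comment> \<open>Multiplication by h \<and> h is X \<mapsto> h \<and> \<rho>(X), which on
    \<open>MC_R\<close> is the scalar by which the Ricci trace acts on trace-free forms.\<close>
  have h: "X \<circledast> ?h = t *\<^sub>R X" if "X \<in> MC_R" for X
  proof -
    obtain \<alpha> where a: "\<alpha> \<in> sym_forms" "trace_form \<alpha> = 0" "X = curlywedge inner \<alpha>" using \<open>X \<in> MC_R\<close> by (rule MC_R_E)
    then show ?thesis
      using mult_curlywedge_inner[of X] MC_R_subset_MC that ricci_curlywedge_trace_free[OF a(1,2)]
      by (auto simp: curlywedge_scaleR_right t_def)
  qed
  show "(MC_R :: 'a form4 set) \<circledast>\<^sub>s MC_S \<subseteq> MC_R"
  proof (rule mult_span_subset[OF _ subspace_MC_R])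
    fix X Y :: "'a form4" assume X: "X \<in> MC_R" and "Y \<in> MC_S"
    then obtain d where Y: "Y = d *\<^sub>R ?h" by (metis MC_S_E)
    show "X \<circledast> Y \<in> MC_R"
      unfolding Y mult_scaleR_right h[OF X] by (intro subspace_scale[OF subspace_MC_R] X)
  qed
  show "MC_R \<subseteq> (MC_R :: 'a form4 set) \<circledast>\<^sub>s MC_S"
  proof
    fix X :: "'a form4" assume X: "X \<in> MC_R"
    have "X = (1 / t) *\<^sub>R (X \<circledast> ?h)" using t unfolding h[OF X] by simp
    also have "\<dots> \<in> MC_R \<circledast>\<^sub>s MC_S"
      using X by (intro subspace_scale[OF subspace_mult_span] mult_in_mult_span MC_S_I)
    finally show "X \<in> MC_R \<circledast>\<^sub>s MC_S" .
  qed
qed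

lemma MC_W_mult_MC_S: "(MC_W :: ('a::euclidean_space) form4 set) \<circledast>\<^sub>s MC_S = {0}"
proof
  show "(MC_W :: 'a form4 set) \<circledast>\<^sub>s MC_S \<subseteq> {0}"
  proof (rule mult_span_subset[OF _ subspace_single_0])
    fix X Y :: "'a form4" assume X: "X \<in> MC_W" and "Y \<in> MC_S"
    then obtain d where Y: "Y = d *\<^sub>R curlywedge inner inner" by (metis MC_S_E)
    have "X \<circledast> curlywedge inner inner = curlywedge inner 0"
      using mult_curlywedge_inner[of X] X ricci_MC_W[OF X] by (simp add: MC_W_def)
    also have "\<dots> = 0" by (intro ext) (simp add: curlywedge_def)
    finally show "X \<circledast> Y \<in> {0}" by (simp add: Y mult_scaleR_right)
  qed
qed (simp add: subspace_0[OF subspace_mult_span])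

lemma mult_W_R:
  assumes "X \<in> MC_W" "\<alpha> \<in> sym_forms"
  shows "X \<circledast> curlywedge inner \<alpha> = (1/2) *\<^sub>R curlywedge inner (hat2 X \<alpha>)"
proof -
  have "curlywedge 0 \<alpha> = 0" by (intro ext) (simp add: curlywedge_def)
  then show ?thesis using mult_curlywedge[of X \<alpha>] assms ricci_MC_W[OF assms(1)] by (simp add: MC_W_def)
qed

lemma MC_W_mult_MC_R:
  assumes dim: "DIM('a::euclidean_space) > 3"
  shows "(MC_W :: 'a form4 set) \<circledast>\<^sub>s MC_R = MC_R"
proof
  show "(MC_W :: 'a form4 set) \<circledast>\<^sub>s MC_R \<subseteq> MC_R"
  proof (rule mult_span_subset[OF _ subspace_MC_R])
    fix X Y :: "'a form4" assume X: "X \<in> MC_W" and "Y \<in> MC_R"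
    then obtain \<alpha> where \<alpha>: "\<alpha> \<in> sym_forms" "Y = curlywedge inner \<alpha>" by (metis MC_R_E)
    have "X \<in> MC" using X by (simp add: MC_W_def)
    then show "X \<circledast> Y \<in> MC_R"
      unfolding \<alpha>(2) mult_W_R[OF X \<alpha>(1)]
      by (intro subspace_scale[OF subspace_MC_R] MC_R_I hat2_in_sym_forms \<alpha>(1) trace_hat2_W X)
  qed
  \<comment> \<open>Pulling the product space back along \<alpha> \<mapsto> h \<and> \<alpha> gives
    a subspace of forms, to which the spanning result for trace-free forms applies.\<close>
  let ?S = "{\<alpha>. curlywedge inner \<alpha> \<in> (MC_W :: 'a form4 set) \<circledast>\<^sub>s MC_R}"
  have "curlywedge inner 0 = (0 :: 'a form4)" by (intro ext) (simp add: curlywedge_def)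
  then have S: "subspace ?S"
    by (intro subspaceI) (simp_all add: curlywedge_add_right curlywedge_scaleR_right
        subspace_0 subspace_add subspace_scale subspace_mult_span)
  have "sqdiff a b \<in> ?S" if o: "orthonormal4 a b c d" for a b c d
  proof -
    have "weyl4 a b c d \<circledast> curlywedge inner (sqdiff c d) = (-1) *\<^sub>R curlywedge inner (sqdiff a b)"
      unfolding mult_W_R[OF weyl4_in_MC_W[OF o] sqdiff_in_sym_forms] hat2_weyl4[OF o] curlywedge_scaleR_right by simp
    then have "curlywedge inner (sqdiff a b) = (-1) *\<^sub>R (weyl4 a b c d \<circledast> curlywedge inner (sqdiff c d))" by simp
    also have "\<dots> \<in> MC_W \<circledast>\<^sub>s MC_R"
      using o by (intro subspace_scale[OF subspace_mult_span] mult_in_mult_span weyl4_in_MC_W MC_R_I sqdiff_in_sym_forms)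
        (simp_all add: trace_sqdiff orthonormal4_def)
    finally show ?thesis by simp
  qed
  then show "MC_R \<subseteq> (MC_W :: 'a form4 set) \<circledast>\<^sub>s MC_R"
    using trace_free_form_induct[OF _ _ dim S] by (auto elim!: MC_R_E)
qed

lemma tf_MC_R_mult_MC_R:
  assumes dim: "DIM('a::euclidean_space) > 3"
  shows "tf ` ((MC_R :: 'a form4 set) \<circledast>\<^sub>s MC_R) = MC_W"
proof
  have dim2: "DIM('a) > 2" using dim by simp
  have sub: "(MC_R :: 'a form4 set) \<circledast>\<^sub>s MC_R \<subseteq> MC"
    using MC_R_subset_MC by (intro mult_span_subset subspace_MC mult_in_MC) auto
  show "tf ` ((MC_R :: 'a form4 set) \<circledast>\<^sub>s MC_R) \<subseteq> MC_W"
  proof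
    fix x assume "x \<in> tf ` ((MC_R :: 'a form4 set) \<circledast>\<^sub>s MC_R)"
    then obtain X :: "'a form4" where "X \<in> MC" "x = tf X" using sub by blast
    then show "x \<in> MC_W" using tf_eq MC_decomposition[OF _ dim2] by metis
  qed
  have T: "subspace (tf ` ((MC_R :: 'a form4 set) \<circledast>\<^sub>s MC_R))"
    by (rule subspace_tf_image[OF subspace_mult_span sub dim2])
  have "weyl4 a b c d \<in> tf ` (MC_R \<circledast>\<^sub>s MC_R)" if o: "orthonormal4 a b c d" for a b c d :: 'a
  proof -
    have R: "curlywedge inner (sqdiff a b) \<in> MC_R" "curlywedge inner (sqdiff c d) \<in> MC_R"
      using o by (auto intro!: MC_R_I sqdiff_in_sym_forms simp: trace_sqdiff orthonormal4_def)
    \<comment> \<open>The product of 1/2 from \<open>mult_curlywedge\<close>, (2 - n)/2 from the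
      Ricci trace of h \<and> \<alpha>, and 1/2 from \<open>curlywedge_sqdiff\<close>. The rest of
      the product is h wedged with a form, which \<open>tf\<close> removes.\<close>
    define t where "t = (2 - real DIM('a)) / 8"
    have t: "t \<noteq> 0" using dim by (simp add: t_def)
    let ?X = "curlywedge inner (sqdiff a b) \<circledast> curlywedge inner (sqdiff c d)"
    have tr: "trace_form (sqdiff a b) = 0" using o by (simp add: trace_sqdiff orthonormal4_def)
    have "?X = t *\<^sub>R weyl4 a b c d + curlywedge inner ((1/2) *\<^sub>R hat2 (curlywedge inner (sqdiff a b)) (sqdiff c d))"
      unfolding mult_curlywedge[OF subsetD[OF MC_R_subset_MC R(1)] sqdiff_in_sym_forms]
        ricci_curlywedge_trace_free[OF sqdiff_in_sym_forms tr] curlywedge_scaleR_left curlywedge_scaleR_right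
        curlywedge_sqdiff
      by (simp add: t_def scaleR_add_right)
    then have "tf ?X = t *\<^sub>R weyl4 a b c d"
      using tf_eq subspace_scale[OF subspace_MC_W weyl4_in_MC_W[OF o]] by metis
    then have "t *\<^sub>R weyl4 a b c d \<in> tf ` (MC_R \<circledast>\<^sub>s MC_R)"
      using mult_in_mult_span[OF R] by (metis imageI)
    from subspace_scale[OF T this, of "1 / t"] show ?thesis using t by simp
  qed
  then show "MC_W \<subseteq> tf ` ((MC_R :: 'a form4 set) \<circledast>\<^sub>s MC_R)"
    unfolding MC_W_eq_span_weyl4[OF dim] by (intro span_minimal T) blast
qed

lemma MC_W_mult_MC_W:
  assumes dim: "DIM('a::euclidean_space) > 3"
  shows "(MC_W :: 'a form4 set) \<circledast>\<^sub>s MC_W = MC_W"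
proof
  show "(MC_W :: 'a form4 set) \<circledast>\<^sub>s MC_W \<subseteq> MC_W"
    by (intro mult_span_subset mult_W_W subspace_MC_W)
  have "weyl4 a b c d \<in> MC_W \<circledast>\<^sub>s MC_W" if o: "orthonormal4 a b c d" for a b c d :: 'a
  proof -
    have "orthonormal4 a d c b" "orthonormal4 a c d b"
      using o by (auto simp: orthonormal4_def inner_commute)
    then show ?thesis
      unfolding weyl4_as_squares[OF o]
      by (intro subspace_scale subspace_diff subspace_mult_span mult_in_mult_span weyl4_in_MC_W)
  qed
  then have "span {weyl4 a b c d | a b c d :: 'a. orthonormal4 a b c d} \<subseteq> MC_W \<circledast>\<^sub>s MC_W"
    by (intro span_minimal subspace_mult_span) blast
  then show "MC_W \<subseteq> (MC_W :: 'a form4 set) \<circledast>\<^sub>s MC_W"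
    unfolding MC_W_eq_span_weyl4[OF dim, symmetric] .
qed

theorem theorem7p12:
  shows "(DIM('a::euclidean_space) > 1 \<longrightarrow>
            (MC_S :: 'a form4 set) \<circledast>\<^sub>s MC_S = MC_S)
       \<and> (DIM('a) > 2 \<longrightarrow> (MC_R :: 'a form4 set) \<circledast>\<^sub>s MC_S = MC_R)
       \<and> (MC_W :: 'a form4 set) \<circledast>\<^sub>s MC_S = {0}
       \<and> (DIM('a) > 3 \<longrightarrow> (MC_W :: 'a form4 set) \<circledast>\<^sub>s MC_R = MC_R)
       \<and> (DIM('a) > 3 \<longrightarrow> tf ` ((MC_R :: 'a form4 set) \<circledast>\<^sub>s MC_R) = MC_W)
       \<and> (DIM('a) > 3 \<longrightarrow> (MC_W :: 'a form4 set) \<circledast>\<^sub>s MC_W = MC_W)"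
  using MC_S_mult_MC_S MC_R_mult_MC_S MC_W_mult_MC_S MC_W_mult_MC_R tf_MC_R_mult_MC_R MC_W_mult_MC_W
  by blast

end
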